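(* Let $v$ be a vertex that has all iterated bases defined, and let $p$ be an $\mathrm{evenlevel}(v)$ path or an $\mathrm{oddlevel}(v)$ path. Then for each vertex $u$ on $p$, all iterated bases of $u$ lie on $p$.
   Context: $G=(V,E)$ is a finite undirected graph with a matching $M$, with at least one unmatched vertex. Alternating paths are simple paths alternating between unmatched edges (not in $M$) and matched edges (in $M$), starting with an unmatched edge when starting at an unmatched vertex. $l_m$ is the minimum length of an augmenting path (alternating path between two distinct unmatched vertices), $\infty$ if none. $\mathrm{evenlevel}(v)$, $\mathrm{oddlevel}(v)$ are the minimum lengths of even, resp. odd, alternating paths from an unmatched vertex to $v$ ($\infty$ if none); such minimum paths are $\mathrm{evenlevel}(v)$, $\mathrm{oddlevel}(v)$ paths. Tenacity $t(v)=\mathrm{evenlevel}(v)+\mathrm{oddlevel}(v)$. For $t(v)=t<l_m$, $\mathrm{base}(v)$ is the vertex of tenacity $>t$ furthest from the starting unmatched vertex along any $\mathrm{evenlevel}(v)$ or $\mathrm{oddlevel}(v)$ path (known to be independent of the path). Iterated bases: $\mathrm{base}^1(v)=\mathrm{base}(v)$, and $\mathrm{base}^{k+1}(v)=\mathrm{base}(\mathrm{base}^k(v))$ whenever $t(\mathrm{base}^k(v))<l_m$. A vertex $v$ has all iterated bases defined if $\mathrm{base}^k(v)$ is defined and is an unmatched vertex for some $k\in\mathbb{Z}^+$. *)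

theory Defs
  imports "HOL-Library.Extended_Nat"
begin

definition finite_graph :: "'a set \<Rightarrow> 'a set set \<Rightarrow> bool" where
  "finite_graph V E \<longleftrightarrow> finite V \<and> (\<forall>e\<in>E. e \<subseteq> V \<and> card e = 2)"

definition matching :: "'a set set \<Rightarrow> 'a set set \<Rightarrow> bool" where
  "matching E M \<longleftrightarrow> M \<subseteq> E \<and> (\<forall>e\<in>M. \<forall>e'\<in>M. e \<noteq> e' \<longrightarrow> e \<inter> e' = {})"

definition unmatched :: "'a set \<Rightarrow> 'a set set \<Rightarrow> 'a \<Rightarrow> bool" where
  "unmatched V M v \<longleftrightarrow> v \<in> V \<and> v \<notin> \<Union>M"

text \<open>A path is the nonempty list of its vertices; its length is its number of edges, so that a
  single vertex is a path of length 0. If the first vertex is unmatched, the first edge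
  is necessarily outside \<open>M\<close>.\<close>

definition alternating_path :: "'a set \<Rightarrow> 'a set set \<Rightarrow> 'a set set \<Rightarrow> 'a list \<Rightarrow> bool" where
  "alternating_path V E M p \<longleftrightarrow>
     p \<noteq> [] \<and> distinct p \<and> set p \<subseteq> V \<and>
     (\<forall>i. i + 1 < length p \<longrightarrow> {p ! i, p ! (i + 1)} \<in> E) \<and>
     (\<forall>i. i + 2 < length p \<longrightarrow>
        ({p ! i, p ! (i + 1)} \<in> M \<longleftrightarrow> {p ! (i + 1), p ! (i + 2)} \<notin> M))"

definition path_length :: "'a list \<Rightarrow> nat" where
  "path_length p = length p - 1"

definition augmenting_path :: "'a set \<Rightarrow> 'a set set \<Rightarrow> 'a set set \<Rightarrow> 'a list \<Rightarrow> bool" where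
  "augmenting_path V E M p \<longleftrightarrow>
     alternating_path V E M p \<and> unmatched V M (hd p) \<and> unmatched V M (last p) \<and> hd p \<noteq> last p"

text \<open>The infimum of the empty set in \<^typ>\<open>enat\<close> is \<open>\<infinity>\<close>.\<close>

definition min_augmenting_length :: "'a set \<Rightarrow> 'a set set \<Rightarrow> 'a set set \<Rightarrow> enat" where
  "min_augmenting_length V E M = Inf {enat (path_length p) | p. augmenting_path V E M p}"

definition alternating_path_to ::
    "'a set \<Rightarrow> 'a set set \<Rightarrow> 'a set set \<Rightarrow> 'a \<Rightarrow> 'a list \<Rightarrow> bool" where
  "alternating_path_to V E M v p \<longleftrightarrow>
     alternating_path V E M p \<and> unmatched V M (hd p) \<and> last p = v"

definition evenlevel :: "'a set \<Rightarrow> 'a set set \<Rightarrow> 'a set set \<Rightarrow> 'a \<Rightarrow> enat" where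
  "evenlevel V E M v =
     Inf {enat (path_length p) | p. alternating_path_to V E M v p \<and> even (path_length p)}"

definition oddlevel :: "'a set \<Rightarrow> 'a set set \<Rightarrow> 'a set set \<Rightarrow> 'a \<Rightarrow> enat" where
  "oddlevel V E M v =
     Inf {enat (path_length p) | p. alternating_path_to V E M v p \<and> odd (path_length p)}"

definition evenlevel_path ::
    "'a set \<Rightarrow> 'a set set \<Rightarrow> 'a set set \<Rightarrow> 'a \<Rightarrow> 'a list \<Rightarrow> bool" where
  "evenlevel_path V E M v p \<longleftrightarrow>
     alternating_path_to V E M v p \<and> even (path_length p) \<and>
     enat (path_length p) = evenlevel V E M v"

definition oddlevel_path ::
    "'a set \<Rightarrow> 'a set set \<Rightarrow> 'a set set \<Rightarrow> 'a \<Rightarrow> 'a list \<Rightarrow> bool" where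
  "oddlevel_path V E M v p \<longleftrightarrow>
     alternating_path_to V E M v p \<and> odd (path_length p) \<and>
     enat (path_length p) = oddlevel V E M v"

definition tenacity :: "'a set \<Rightarrow> 'a set set \<Rightarrow> 'a set set \<Rightarrow> 'a \<Rightarrow> enat" where
  "tenacity V E M v = evenlevel V E M v + oddlevel V E M v"

definition furthest_of_higher_tenacity ::
    "'a set \<Rightarrow> 'a set set \<Rightarrow> 'a set set \<Rightarrow> enat \<Rightarrow> 'a list \<Rightarrow> 'a \<Rightarrow> bool" where
  "furthest_of_higher_tenacity V E M t p b \<longleftrightarrow>
     (\<exists>i < length p. b = p ! i \<and> tenacity V E M b > t \<and>
        (\<forall>j < length p. tenacity V E M (p ! j) > t \<longrightarrow> j \<le> i))"

text \<open>Only meaningful when the tenacity of \<open>v\<close> is smaller than the minimum length of an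
  augmenting path; there the vertex does not depend on the chosen path, a fact
  that is not built into any hypothesis.\<close>

definition base :: "'a set \<Rightarrow> 'a set set \<Rightarrow> 'a set set \<Rightarrow> 'a \<Rightarrow> 'a" where
  "base V E M v =
     (THE b. \<forall>p. evenlevel_path V E M v p \<or> oddlevel_path V E M v p \<longrightarrow>
        furthest_of_higher_tenacity V E M (tenacity V E M v) p b)"

text \<open>\<open>iterated_base V E M v k b\<close> says that the \<open>k\<close>-th iterated base of \<open>v\<close> is defined
  and equal to \<open>b\<close>.\<close>

inductive iterated_base ::
    "'a set \<Rightarrow> 'a set set \<Rightarrow> 'a set set \<Rightarrow> 'a \<Rightarrow> nat \<Rightarrow> 'a \<Rightarrow> bool"
  for V E M v where
  first: "tenacity V E M v < min_augmenting_length V E M \<Longrightarrow>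
            iterated_base V E M v 1 (base V E M v)"
| step: "iterated_base V E M v k b \<Longrightarrow>
            tenacity V E M b < min_augmenting_length V E M \<Longrightarrow>
            iterated_base V E M v (Suc k) (base V E M b)"

definition all_iterated_bases_defined ::
    "'a set \<Rightarrow> 'a set set \<Rightarrow> 'a set set \<Rightarrow> 'a \<Rightarrow> bool" where
  "all_iterated_bases_defined V E M v \<longleftrightarrow>
     (\<exists>k b. iterated_base V E M v k b \<and> unmatched V M b)"

end

theory Submission
  imports Defs
begin

text \<open>The structure of minimum-length alternating paths is read off from a dual certificate. For a
  bound \<open>N\<close> not exceeding the minimum augmenting length, the even and odd levels define vertex
  potentials (the dual variables of a Hungarian search at time \<open>N / 2\<close>), and for each \<open>s < N\<close>
  the map \<open>blossom_base s\<close>, which iterates \<open>base\<close> until the tenacity exceeds \<open>s\<close>, partitions the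
  vertices into blossoms that carry a constant dual weight. If the duals are feasible, summing the
  edge constraints with alternating signs along a path bounds its length from below, and on a
  minimum path to a vertex of tenacity at most \<open>N\<close> the bound is attained; this forces the path to
  pass through each blossom in one contiguous piece that contains the base. In particular the base
  of every vertex of smaller tenacity lies on the path, while up to a vertex of tenacity at least
  that of the end point the path is itself of minimum length, so that the base of that vertex lies
  on it by definition.

  Feasibility and the independence of the base from the path are established together by induction
  on \<open>N\<close>.\<close>

lemma enat_Suc_less: "enat s < t \<Longrightarrow> t \<noteq> enat (Suc s) \<Longrightarrow> enat (Suc s) < t"
  by (simp add: order.strict_iff_order Suc_ile_eq)

lemma nat_change_point:
  assumes "i \<le> k" "P i" "\<not> P k"
  obtains m :: nat where "i \<le> m" "m < k" "P m" "\<not> P (Suc m)"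
  using assms
proof (induction arbitrary: thesis rule: dec_induct)
  case (step n)
  then show ?case by (cases "P n") (auto intro: less_SucI)
qed simp

lemma path_length_conv: "p \<noteq> [] \<Longrightarrow> length p = Suc (path_length p)"
  unfolding path_length_def by simp

lemma nth_path_length: "p \<noteq> [] \<Longrightarrow> p ! path_length p = last p"
  unfolding path_length_def by (simp add: last_conv_nth)

lemma path_length_take_Suc: "i < length p \<Longrightarrow> path_length (take (Suc i) p) = i"
  unfolding path_length_def by simp

lemma path_length_snoc: "path_length (p @ [x]) = length p"
  unfolding path_length_def by simp

lemma last_take_Suc: "i < length p \<Longrightarrow> last (take (Suc i) p) = p ! i"
  by (simp add: take_Suc_conv_app_nth)

lemma last_in_set_drop: "i < length p \<Longrightarrow> last p \<in> set (drop i p)"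
  by (metis drop_eq_Nil last_drop last_in_set not_le)

lemma nth_notin_set_take: "distinct p \<Longrightarrow> i < length p \<Longrightarrow> p ! i \<notin> set (take i p)"
  by (auto simp: in_set_conv_nth nth_eq_iff_index_eq)

lemma set_take_Suc: "i < length p \<Longrightarrow> set (take (Suc i) p) = insert (p ! i) (set (take i p))"
  by (simp add: take_Suc_conv_app_nth)

locale matched_graph =
  fixes V :: "'a set" and E M :: "'a set set"
  assumes finite_graph: "finite_graph V E" and matching: "matching E M"
begin

abbreviation \<tau> :: "'a \<Rightarrow> enat" where
  "\<tau> \<equiv> tenacity V E M"

abbreviation min_aug :: enat where
  "min_aug \<equiv> min_augmenting_length V E M"

lemma matched_unique: "{x, y} \<in> M \<Longrightarrow> {x, z} \<in> M \<Longrightarrow> y = z"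
  using matching unfolding matching_def by (metis doubleton_eq_iff insertI1 disjoint_iff)

lemma edge_distinct: "{x, y} \<in> E \<Longrightarrow> x \<noteq> y"
  using finite_graph unfolding finite_graph_def by fastforce

lemma edge_in_V: "{x, y} \<in> E \<Longrightarrow> x \<in> V \<and> y \<in> V"
  using finite_graph unfolding finite_graph_def by blast

lemma matched_edge: "{x, y} \<in> M \<Longrightarrow> {x, y} \<in> E"
  using matching unfolding matching_def by blast

lemma matched_not_unmatched: "{x, y} \<in> M \<Longrightarrow> \<not> unmatched V M x"
  unfolding unmatched_def by blast

section \<open>Alternating paths from unmatched vertices\<close>

definition alternates :: "bool \<Rightarrow> 'a list \<Rightarrow> bool" where
  "alternates m p \<longleftrightarrow> (\<forall>i. Suc i < length p \<longrightarrow>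
     {p ! i, p ! Suc i} \<in> E \<and> ({p ! i, p ! Suc i} \<in> M \<longleftrightarrow> (m \<longleftrightarrow> even i)))"

lemma alternates_take: "alternates m p \<Longrightarrow> alternates m (take n p)"
  unfolding alternates_def by simp

lemma alternates_drop:
  assumes "alternates m p"
  shows "alternates (m \<longleftrightarrow> even n) (drop n p)"
  unfolding alternates_def
proof (intro allI impI)
  fix i assume "Suc i < length (drop n p)"
  then have "Suc (n + i) < length p" by simp
  then show "{drop n p ! i, drop n p ! Suc i} \<in> E \<and>
      ({drop n p ! i, drop n p ! Suc i} \<in> M \<longleftrightarrow> ((m \<longleftrightarrow> even n) \<longleftrightarrow> even i))"
    using assms unfolding alternates_def by auto
qed

lemma alternates_rev:
  assumes "alternates m p"
  shows "alternates (m \<longleftrightarrow> even (length p)) (rev p)"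
  unfolding alternates_def
proof (intro allI impI)
  fix i assume i: "Suc i < length (rev p)"
  define k where "k = length p - Suc (Suc i)"
  have "length p = Suc (Suc (k + i))" using i unfolding k_def by simp
  then have "rev p ! i = p ! Suc k" "rev p ! Suc i = p ! k" "Suc k < length p"
    "even k \<longleftrightarrow> (even (length p) \<longleftrightarrow> even i)"
    by (auto simp: rev_nth)
  then show "{rev p ! i, rev p ! Suc i} \<in> E \<and>
      ({rev p ! i, rev p ! Suc i} \<in> M \<longleftrightarrow> ((m \<longleftrightarrow> even (length p)) \<longleftrightarrow> even i))"
    using assms unfolding alternates_def by (auto simp: insert_commute)
qed

lemma alternates_append:
  assumes p: "alternates m p" and r: "alternates (m \<longleftrightarrow> even (length p)) r"
    and nonempty: "p \<noteq> []" "r \<noteq> []"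
    and edge: "{last p, hd r} \<in> E" "{last p, hd r} \<in> M \<longleftrightarrow> (m \<longleftrightarrow> odd (length p))"
  shows "alternates m (p @ r)"
  unfolding alternates_def
proof (intro allI impI)
  fix i assume i: "Suc i < length (p @ r)"
  let ?edge = "{(p @ r) ! i, (p @ r) ! Suc i}"
  consider (left) "Suc i < length p" | (junction) "Suc i = length p"
    | (right) d where "i = length p + d"
    using le_Suc_ex by (metis not_less_eq linorder_neqE_nat not_less)
  then show "?edge \<in> E \<and> (?edge \<in> M \<longleftrightarrow> (m \<longleftrightarrow> even i))"
  proof cases
    case left
    then show ?thesis using p unfolding alternates_def by (simp add: nth_append)
  next
    case junction
    then have "?edge = {last p, hd r}" "odd (length p) \<longleftrightarrow> even i"
      using nonempty by (auto simp: nth_append last_conv_nth hd_conv_nth simp flip: junction)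
    then show ?thesis using edge by simp
  next
    case right
    then show ?thesis using r i unfolding alternates_def by (auto simp: nth_append)
  qed
qed

definition search_path :: "'a list \<Rightarrow> bool" where
  "search_path p \<longleftrightarrow> alternating_path V E M p \<and> unmatched V M (hd p)"

lemma search_path_iff:
  "search_path p \<longleftrightarrow>
     p \<noteq> [] \<and> distinct p \<and> set p \<subseteq> V \<and> unmatched V M (hd p) \<and> alternates False p"
proof
  assume p: "search_path p"
  then have start: "unmatched V M (p ! 0)"
    unfolding search_path_def alternating_path_def by (metis hd_conv_nth)
  have "{p ! i, p ! Suc i} \<in> M \<longleftrightarrow> odd i" if "Suc i < length p" for i
    using that
  proof (induction i)
    case 0
    then show ?case using start matched_not_unmatched by auto
  next
    case (Suc i)
    moreover have "{p ! i, p ! Suc i} \<in> M \<longleftrightarrow> {p ! Suc i, p ! Suc (Suc i)} \<notin> M"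
      using p Suc.prems unfolding search_path_def alternating_path_def by auto
    ultimately show ?case by auto
  qed
  then show "p \<noteq> [] \<and> distinct p \<and> set p \<subseteq> V \<and> unmatched V M (hd p) \<and> alternates False p"
    using p unfolding search_path_def alternating_path_def alternates_def by auto
qed (auto simp: search_path_def alternating_path_def alternates_def)

lemma
  assumes "search_path p"
  shows search_path_nonempty: "p \<noteq> []" and search_path_distinct: "distinct p"
    and search_path_subset: "set p \<subseteq> V" and search_path_start: "unmatched V M (p ! 0)"
    and search_path_alternates: "alternates False p"
    and search_path_length: "length p = Suc (path_length p)"
    and search_path_nth_last: "p ! path_length p = last p"
  using assms unfolding search_path_iff by (auto simp: hd_conv_nth path_length_conv nth_path_length)

lemma
  assumes "search_path p" "Suc i < length p"
  shows search_path_edge: "{p ! i, p ! Suc i} \<in> E"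
    and search_path_matched_iff: "{p ! i, p ! Suc i} \<in> M \<longleftrightarrow> odd i"
  using search_path_alternates[OF assms(1)] assms(2) unfolding alternates_def by auto

lemma search_path_take:
  assumes "search_path p" "0 < n"
  shows "search_path (take n p)"
  using assms unfolding search_path_iff by (auto simp: alternates_take dest: in_set_takeD)

lemma search_path_append:
  assumes "search_path q"
    and "alternates (odd (length q)) r" "r \<noteq> []" "distinct r" "set r \<subseteq> V" "set q \<inter> set r = {}"
    and "{last q, hd r} \<in> E" "{last q, hd r} \<in> M \<longleftrightarrow> even (length q)"
  shows "search_path (q @ r)"
  using assms alternates_append[of False q r] unfolding search_path_iff by auto

lemma search_path_snoc:
  assumes "search_path q" "y \<notin> set q" "{last q, y} \<in> E" "{last q, y} \<in> M \<longleftrightarrow> even (length q)"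
  shows "search_path (q @ [y])"
  using assms edge_in_V[of "last q" y] by (intro search_path_append) (auto simp: alternates_def)

lemma search_path_splice:
  assumes q: "search_path q" and j: "j < length q"
    and r: "alternates (odd j) r" "r \<noteq> []" "distinct r" "set r \<subseteq> V" "hd r = q ! j"
    and disjoint: "\<And>a. a < j \<Longrightarrow> q ! a \<notin> set r"
  shows "search_path (take j q @ r)"
proof (cases j)
  case 0
  then show ?thesis using r search_path_start[OF q] unfolding search_path_iff by simp
next
  case (Suc i)
  then have "last (take j q) = q ! i" using j by (simp add: last_take_Suc)
  moreover have "set (take j q) \<inter> set r = {}"
    using disjoint j by (auto simp: set_conv_nth)
  ultimately show ?thesis
    using r j Suc search_path_take[OF q, of j] search_path_matched_iff[OF q, of i]
      search_path_edge[OF q, of i]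
    by (intro search_path_append) auto
qed

lemma mate_at_odd_index:
  assumes "search_path p" "odd i" "Suc i < length p" "{p ! i, y} \<in> M"
  shows "p ! Suc i = y"
  using assms search_path_matched_iff[of p i] matched_unique by blast

lemma mate_at_even_index:
  assumes p: "search_path p" and i: "even i" "i < length p" and mates: "{p ! i, y} \<in> M"
  obtains k where "i = Suc k" "p ! k = y"
proof (cases i)
  case 0
  then show ?thesis using mates search_path_start[OF p] matched_not_unmatched by metis
next
  case (Suc k)
  then have "{p ! i, p ! k} \<in> M"
    using search_path_matched_iff[OF p, of k] i by (simp add: insert_commute)
  then show ?thesis using that Suc mates matched_unique by blast
qed

lemma mate_notin_odd_search_path:
  assumes q: "search_path q" and odd: "odd (path_length q)" and mates: "{last q, x} \<in> M"
  shows "x \<notin> set q"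
proof
  assume "x \<in> set q"
  then obtain i where i: "i < length q" "q ! i = x" by (auto simp: in_set_conv_nth)
  then have mate: "{q ! i, last q} \<in> M" using mates by (simp add: insert_commute)
  have "\<exists>k. q ! k = last q \<and> k < length q \<and> k \<noteq> path_length q"
  proof (cases "odd i")
    case True
    have "i \<noteq> path_length q"
      using i search_path_nth_last[OF q] edge_distinct[OF matched_edge[OF mates]] by auto
    then have Suc_less: "Suc i < length q" using i search_path_length[OF q] by simp
    have "even (Suc i)" using True by simp
    then have "Suc i \<noteq> path_length q" using odd by metis
    then show ?thesis using mate_at_odd_index[OF q True Suc_less mate] Suc_less by (intro exI conjI)
  next
    case False
    then obtain k where "i = Suc k" "q ! k = last q"
      using mate_at_even_index[OF q _ i(1) mate] by blast
    then show ?thesis using i search_path_length[OF q] by (intro exI[of _ k]) auto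
  qed
  then show False
    using nth_eq_iff_index_eq[OF search_path_distinct[OF q]] search_path_length[OF q]
      search_path_nth_last[OF q]
    by (metis lessI)
qed

section \<open>Levels and tenacity\<close>

definition level :: "bool \<Rightarrow> 'a \<Rightarrow> enat" where
  "level ev v = (if ev then evenlevel V E M v else oddlevel V E M v)"

definition min_path :: "'a \<Rightarrow> 'a list \<Rightarrow> bool" where
  "min_path v p \<longleftrightarrow> evenlevel_path V E M v p \<or> oddlevel_path V E M v p"

lemma level_eq_Inf:
  "level ev v =
     Inf {enat (path_length p) | p. search_path p \<and> last p = v \<and> even (path_length p) = ev}"
  unfolding level_def evenlevel_def oddlevel_def alternating_path_to_def search_path_def
  by (simp add: conj_assoc)

lemma min_path_iff:
  "min_path v p \<longleftrightarrow> search_path p \<and> last p = v \<and>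
     level (even (path_length p)) v = enat (path_length p)"
  unfolding min_path_def evenlevel_path_def oddlevel_path_def alternating_path_to_def
    search_path_def level_def by auto

lemma
  assumes "min_path v p"
  shows min_path_search_path: "search_path p" and min_path_last: "last p = v"
    and min_path_level: "level (even (path_length p)) v = enat (path_length p)"
  using assms unfolding min_path_iff by auto

lemma min_path_length: "min_path v p \<Longrightarrow> length p = Suc (path_length p)"
  using search_path_length[OF min_path_search_path] .

lemma min_path_nth_eq_iff:
  assumes p: "min_path v p" and k: "k < length p"
  shows "p ! k = v \<longleftrightarrow> k = path_length p"
proof -
  note p_path = min_path_search_path[OF p]
  have "path_length p < length p" using min_path_length[OF p] by simp
  then show ?thesis
    using nth_eq_iff_index_eq[OF search_path_distinct[OF p_path] k] search_path_nth_last[OF p_path]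
      min_path_last[OF p] by metis
qed

lemma min_path_nth_last: "min_path v p \<Longrightarrow> p ! path_length p = v"
  using min_path_nth_eq_iff min_path_length by simp

lemma tenacity_eq_levels: "\<tau> v = level ev v + level (\<not> ev) v"
  unfolding tenacity_def level_def by (simp add: add.commute)

lemma level_finite: "\<tau> v \<noteq> \<infinity> \<Longrightarrow> level ev v \<noteq> \<infinity>"
  unfolding tenacity_eq_levels[of v ev] by (metis plus_enat_simps(2))

lemma level_last_le: "search_path p \<Longrightarrow> level (even (path_length p)) (last p) \<le> enat (path_length p)"
  unfolding level_eq_Inf by (rule Inf_lower) auto

lemma level_nth_le:
  assumes "search_path p" "i < length p"
  shows "level (even i) (p ! i) \<le> enat i"
  using level_last_le[OF search_path_take[of p "Suc i"]] assms
  by (simp add: last_take_Suc path_length_take_Suc)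

lemma min_path_exists:
  assumes "level ev v \<noteq> \<infinity>"
  obtains p where "min_path v p" "even (path_length p) = ev"
proof -
  let ?A = "{enat (path_length p) | p. search_path p \<and> last p = v \<and> even (path_length p) = ev}"
  have "?A \<noteq> {}" using assms unfolding level_eq_Inf Inf_enat_def by (metis (lifting))
  then have "Inf ?A \<in> ?A" by (rule wellorder_InfI[OF some_in_eq[THEN iffD2]])
  then show ?thesis using that unfolding min_path_iff level_eq_Inf by force
qed

lemma min_path_take:
  assumes "search_path p" "i < length p" "level (even i) (p ! i) = enat i"
  shows "min_path (p ! i) (take (Suc i) p)"
  using assms search_path_take[of p "Suc i"] unfolding min_path_iff
  by (simp add: last_take_Suc path_length_take_Suc)

lemma min_paths_exist:
  assumes "\<tau> v \<noteq> \<infinity>"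
  obtains p r where "min_path v p" "even (path_length p)" "min_path v r" "odd (path_length r)"
  using level_finite[OF assms] by (metis (full_types) min_path_exists)

lemma level_even_mate_le:
  assumes mates: "{x, y} \<in> M"
  shows "level True x \<le> level False y + 1"
proof (cases "level False y = \<infinity>")
  case False
  then obtain q where q: "min_path y q" and odd: "odd (path_length q)"
    by (metis (full_types) min_path_exists)
  note q_path = min_path_search_path[OF q]
  have last_mate: "{last q, x} \<in> M" using mates min_path_last[OF q] by (simp add: insert_commute)
  have "search_path (q @ [x])"
    using mate_notin_odd_search_path[OF q_path odd last_mate] last_mate matched_edge q_path
      min_path_length[OF q] odd
    by (intro search_path_snoc) auto
  from level_last_le[OF this] show ?thesis
    using min_path_level[OF q] odd min_path_length[OF q]
    by (simp add: path_length_snoc one_enat_def)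
qed simp

lemma even_min_path_ends_with_mate:
  assumes p: "min_path x p" "even (path_length p)" and mates: "{x, y} \<in> M"
  obtains k where "path_length p = Suc k" "p ! k = y"
  using mate_at_even_index[OF min_path_search_path[OF p(1)] p(2)] min_path_length[OF p(1)]
    min_path_nth_last[OF p(1)] mates by auto

lemma level_odd_mate_le:
  assumes mates: "{x, y} \<in> M"
  shows "level False y + 1 \<le> level True x"
proof (cases "level True x = \<infinity>")
  case False
  then obtain p where p: "min_path x p" and even: "even (path_length p)"
    by (metis (full_types) min_path_exists)
  obtain k where k: "path_length p = Suc k" "p ! k = y"
    using even_min_path_ends_with_mate[OF p even mates] .
  then have "level False y \<le> enat k"
    using level_nth_le[OF min_path_search_path[OF p], of k] even min_path_length[OF p] by simp
  then show ?thesis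
    using min_path_level[OF p] even k(1) by (cases "level False y") (auto simp: one_enat_def)
qed simp

lemma level_even_mate: "{x, y} \<in> M \<Longrightarrow> level True x = level False y + 1"
  using level_even_mate_le level_odd_mate_le by (simp add: order_antisym)

lemma tenacity_mate:
  assumes "{x, y} \<in> M"
  shows "\<tau> x = \<tau> y"
  using level_even_mate[OF assms] level_even_mate[of y x] assms
  unfolding tenacity_eq_levels[of _ True] by (simp add: insert_commute ac_simps)

lemma level_even_unmatched:
  assumes "unmatched V M f"
  shows "level True f = 0"
proof -
  have "search_path [f]" using assms unfolding search_path_iff unmatched_def alternates_def by simp
  from level_last_le[OF this] show ?thesis by (simp add: path_length_def zero_enat_def[symmetric])
qed

lemma tenacity_unmatched_ge:
  assumes unmatched: "unmatched V M f"
  shows "min_aug \<le> \<tau> f"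
proof (cases "level False f = \<infinity>")
  case True
  then show ?thesis unfolding tenacity_eq_levels[of f False] by simp
next
  case False
  then obtain p where p: "min_path f p" and odd: "odd (path_length p)"
    by (metis (full_types) min_path_exists)
  note p_path = min_path_search_path[OF p]
  have "path_length p \<noteq> 0" using odd by (metis even_zero)
  then have "hd p \<noteq> last p"
    using min_path_nth_eq_iff[OF p, of 0] min_path_last[OF p] search_path_nonempty[OF p_path]
    by (simp add: hd_conv_nth)
  then have "augmenting_path V E M p"
    using p_path min_path_last[OF p] unmatched unfolding augmenting_path_def search_path_def by auto
  then have "min_aug \<le> enat (path_length p)"
    unfolding min_augmenting_length_def by (intro Inf_lower) auto
  then show ?thesis
    using min_path_level[OF p] odd level_even_unmatched[OF unmatched]
    unfolding tenacity_eq_levels[of f True] by simp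
qed

lemma tenacity_pos: "0 < \<tau> v"
proof (cases "level False v = \<infinity>")
  case False
  then obtain p where "min_path v p" "odd (path_length p)" by (metis (full_types) min_path_exists)
  then have "level False v = enat (path_length p)" "path_length p \<noteq> 0"
    using min_path_level by (fastforce, metis even_zero)
  then show ?thesis
    unfolding tenacity_eq_levels[of v True]
    by (metis add_nonneg_pos enat_0_iff(1) i0_lb not_gr_zero)
qed (simp add: tenacity_eq_levels[of v True])

section \<open>Splicing paths\<close>

lemma level_le_splice_forward:
  assumes p: "search_path p" and q: "search_path q" and i: "i < length p" and j: "j < length q"
    and meet: "p ! i = q ! j" and parity: "even i = even j"
    and disjoint: "\<And>a. a < j \<Longrightarrow> q ! a \<notin> set (drop i p)"
  shows "level (even (path_length p)) (last p) \<le> enat (j + (path_length p - i))"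
proof -
  let ?w = "take j q @ drop i p"
  have "alternates (odd j) (drop i p)"
    using alternates_drop[OF search_path_alternates[OF p], of i] i parity by simp
  then have "search_path ?w"
    using i search_path_distinct[OF p] search_path_subset[OF p] meet disjoint
      set_drop_subset[of i p]
    by (intro search_path_splice[OF q j]) (auto simp: hd_drop_conv_nth)
  moreover have "path_length ?w = j + (path_length p - i)" "last ?w = last p"
    using i j unfolding path_length_def by auto
  moreover have "even (path_length ?w) = even (path_length p)"
    using i parity search_path_length[OF p] unfolding calculation(2) by auto
  ultimately show ?thesis using level_last_le[of ?w] by simp
qed

lemma level_le_splice_backward:
  assumes p: "search_path p" and q: "search_path q" and i: "i < length p" and j: "j < length q"
    and h: "h \<le> i" and meet: "p ! i = q ! j" and parity: "even i \<noteq> even j"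
    and disjoint: "\<And>a. a < j \<Longrightarrow> q ! a \<notin> set (drop h p)"
  shows "level (odd h) (p ! h) \<le> enat (j + (i - h))"
proof -
  define s where "s = drop h (take (Suc i) p)"
  let ?w = "take j q @ rev s"
  have s: "length s = Suc i - h" "s \<noteq> []" "hd s = p ! h" "last s = p ! i" "distinct s"
    using h i search_path_distinct[OF p] unfolding s_def
    by (auto simp: hd_drop_conv_nth last_take_Suc)
  have sub: "set s \<subseteq> set (drop h p)" unfolding s_def drop_take by (rule set_take_subset)
  have "alternates (odd h) s"
    using alternates_drop[OF alternates_take[OF search_path_alternates[OF p]], of h "Suc i"] h i
    unfolding s_def by simp
  then have "alternates (odd j) (rev s)"
    using alternates_rev[of "odd h" s] h parity unfolding s(1) by auto
  then have "search_path ?w"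
    using s sub search_path_subset[OF p] meet disjoint set_drop_subset[of h p]
    by (intro search_path_splice[OF q j]) (auto simp: hd_rev)
  moreover have "path_length ?w = j + (i - h)" "last ?w = p ! h"
    using h j s unfolding path_length_def by (auto simp: last_rev)
  moreover have "even (j + (i - h)) = odd h" using h parity by auto
  ultimately show ?thesis using level_last_le[of ?w] by simp
qed

lemma level_le_splice_edge:
  assumes p: "search_path p" and q: "search_path q" and h: "h < length p"
    and even: "even (path_length p)" "even (path_length q)"
    and edge: "{last q, last p} \<in> E" "{last q, last p} \<notin> M"
    and disjoint: "set q \<inter> set (drop h p) = {}"
  shows "level (odd h) (p ! h) \<le> enat (length q + (path_length p - h))"
proof -
  let ?w = "q @ rev (drop h p)"
  have odd: "odd (length q)" "odd (length p)"
    using even search_path_length[OF p] search_path_length[OF q] by auto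
  have "alternates (odd (length q)) (rev (drop h p))"
    using alternates_rev[OF alternates_drop[OF search_path_alternates[OF p], of h]] h odd by auto
  then have "search_path ?w"
    using h search_path_distinct[OF p] search_path_subset[OF p] odd edge disjoint
      set_drop_subset[of h p]
    by (intro search_path_append[OF q]) (auto simp: hd_rev)
  moreover have "path_length ?w = length q + (path_length p - h)" "last ?w = p ! h"
    using h unfolding path_length_def by (auto simp: last_rev hd_drop_conv_nth)
  moreover have "even (length q + (path_length p - h)) = odd h"
    using h odd(1) even(1) search_path_length[OF p] by auto
  ultimately show ?thesis using level_last_le[of ?w] by simp
qed

lemma tenacity_nth_le_if_opposite_level_le:
  assumes "search_path p" "h < length p" "level (odd h) (p ! h) \<le> enat m"
  shows "\<tau> (p ! h) \<le> enat (h + m)"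
  unfolding tenacity_eq_levels[of "p ! h" "even h"] plus_enat_simps(1)[symmetric]
  using level_nth_le[OF assms(1,2)] assms(3) by (rule add_mono)

lemma tenacity_nth_le_splice_edge:
  assumes "search_path p" "search_path q" "h < length p" "even (path_length p)"
    "even (path_length q)"
    "{last q, last p} \<in> E" "{last q, last p} \<notin> M" "set q \<inter> set (drop h p) = {}"
  shows "\<tau> (p ! h) \<le> enat (Suc (path_length p + path_length q))"
proof -
  have "h + (length q + (path_length p - h)) = Suc (path_length p + path_length q)"
    using assms(3) search_path_length[OF assms(1)] search_path_length[OF assms(2)] by simp
  then show ?thesis
    using tenacity_nth_le_if_opposite_level_le[OF assms(1,3) level_le_splice_edge[OF assms]] by simp
qed

lemma level_odd_le_edge:
  assumes p: "search_path p" "even (path_length p)" and edge: "{last p, y} \<in> E" "{last p, y} \<notin> M"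
    and y: "\<And>k. k < length p \<Longrightarrow> p ! k = y \<Longrightarrow> odd k"
  shows "level False y \<le> enat (length p)"
proof (cases "y \<in> set p")
  case True
  then obtain k where k: "k < length p" "p ! k = y" by (auto simp: in_set_conv_nth)
  then have "level False y \<le> enat k" using level_nth_le[OF p(1) k(1)] y[OF k] by simp
  also have "\<dots> \<le> enat (length p)" using k(1) by simp
  finally show ?thesis .
next
  case False
  have odd: "odd (length p)" using p(2) search_path_length[OF p(1)] by simp
  then have "search_path (p @ [y])" using p(1) False edge by (intro search_path_snoc) auto
  from level_last_le[OF this] show ?thesis using odd by (simp add: path_length_snoc)
qed

lemma min_path_first_meeting:
  assumes p: "min_path v p" and i: "i < length p" and q: "search_path q"
    and a: "a < length q" "q ! a \<in> set (drop i p)"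
  obtains (same_parity) j k where "j \<le> a" "i \<le> k" "k < length p" "q ! j = p ! k"
    "even j = even k" "k \<le> j"
  | (opposite_parity) j k where "j \<le> a" "i \<le> k" "k < length p" "q ! j = p ! k"
    "even j \<noteq> even k" "level (odd i) (p ! i) \<le> enat (j + (k - i))"
proof -
  note p_path = min_path_search_path[OF p]
  define j where "j = (LEAST j. q ! j \<in> set (drop i p))"
  have j: "q ! j \<in> set (drop i p)" "j \<le> a" "\<And>j'. j' < j \<Longrightarrow> q ! j' \<notin> set (drop i p)"
    using a(2) unfolding j_def by (auto intro: LeastI Least_le dest: not_less_Least)
  then obtain d where "d < length (drop i p)" "drop i p ! d = q ! j" by (metis in_set_conv_nth)
  then obtain k where k: "i \<le> k" "k < length p" "q ! j = p ! k"
    using i by (intro that[of "i + d"]) auto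
  show ?thesis
  proof (cases "even j = even k")
    case True
    have "set (drop k p) \<subseteq> set (drop i p)" using k(1) by (rule set_drop_subset_set_drop)
    then have "level (even (path_length p)) (last p) \<le> enat (j + (path_length p - k))"
      using j k a True by (intro level_le_splice_forward[OF p_path q]) auto
    then have "k \<le> j" using min_path_last[OF p] min_path_level[OF p] k min_path_length[OF p] by simp
    then show ?thesis using same_parity j k True by blast
  next
    case False
    have "level (odd i) (p ! i) \<le> enat (j + (k - i))"
      using j k a False by (intro level_le_splice_backward[OF p_path q]) auto
    then show ?thesis using opposite_parity j k False by blast
  qed
qed

lemma tenacity_eq_path_lengths:
  assumes "min_path v p" "min_path v r" "even (path_length p) \<noteq> even (path_length r)"
  shows "\<tau> v = enat (path_length p + path_length r)"
proof -
  have "even (path_length r) = (\<not> even (path_length p))" using assms(3) by blast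
  then have "level (\<not> even (path_length p)) v = enat (path_length r)"
    using min_path_level[OF assms(2)] by simp
  then show ?thesis
    unfolding tenacity_eq_levels[of v "even (path_length p)"] min_path_level[OF assms(1)] by simp
qed

text \<open>If \<open>u = p ! i\<close> had a shorter path, follow first a minimum path to \<open>v\<close> of the other parity and
  then that shorter path until they meet the part of \<open>p\<close> after \<open>u\<close>: each time either \<open>p\<close> can be
  shortened or \<open>u\<close> is reached backwards with the other parity, which bounds its tenacity.\<close>

lemma level_nth_min_path:
  assumes p: "min_path v p" and finite_tenacity: "\<tau> v \<noteq> \<infinity>"
    and i: "i < length p" and tenacity_le: "\<tau> v \<le> \<tau> (p ! i)"
  shows "level (even i) (p ! i) = enat i"
proof (rule ccontr)
  assume "level (even i) (p ! i) \<noteq> enat i"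
  moreover have "level (even i) (p ! i) \<le> enat i"
    using level_nth_le min_path_search_path[OF p] i by blast
  ultimately have shorter: "level (even i) (p ! i) < enat i" by simp
  then have "level (even i) (p ! i) \<noteq> \<infinity>" by (metis enat_ord_simps(6))
  then obtain q where q: "min_path (p ! i) q" "even (path_length q) = even i"
    by (rule min_path_exists)
  obtain r where r: "min_path v r" "even (path_length r) = odd (path_length p)"
    using level_finite[OF finite_tenacity] by (rule min_path_exists)
  note r_path = min_path_search_path[OF r(1)] and q_path = min_path_search_path[OF q(1)]
  define a where "a = path_length q"
  have a: "a < i" "level (even i) (p ! i) = enat a"
    using shorter min_path_level[OF q(1)] q(2) unfolding a_def by auto
  have meets: "i \<le> b \<or> path_length r + i \<le> a + b"
    if w: "search_path w" "b < length w" "w ! b \<in> set (drop i p)" for w b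
    using p i w
  proof (cases rule: min_path_first_meeting)
    case (opposite_parity j k)
    have "enat (path_length p + path_length r) \<le> \<tau> (p ! i)"
      using tenacity_eq_path_lengths[OF p r(1)] r(2) tenacity_le by auto
    also have "\<dots> \<le> enat a + enat (j + (k - i))"
      unfolding tenacity_eq_levels[of "p ! i" "even i"] a(2) using opposite_parity
      by (intro add_left_mono) simp
    finally have "path_length p + path_length r \<le> a + (j + (k - i))" by simp
    then show ?thesis using opposite_parity(1-3) min_path_length[OF p] by linarith
  qed linarith
  have "r ! path_length r \<in> set (drop i p)"
    using last_in_set_drop[OF i] min_path_last[OF p] min_path_nth_last[OF r(1)] by simp
  then have "i \<le> path_length r"
    using meets[OF r_path, of "path_length r"] min_path_length[OF r(1)] a(1) by auto
  moreover have "q ! a \<in> set (drop i p)"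
    using i min_path_nth_last[OF q(1)] unfolding a_def by (simp flip: Cons_nth_drop_Suc)
  then have "path_length r + i \<le> a + a"
    using meets[OF q_path, of a] min_path_length[OF q(1)] a(1) unfolding a_def by auto
  ultimately show False using a(1) by linarith
qed

lemma min_path_prefix:
  assumes "min_path v p" "\<tau> v \<noteq> \<infinity>" "i < length p" "\<tau> v \<le> \<tau> (p ! i)"
  shows "min_path (p ! i) (take (Suc i) p)"
  using assms level_nth_min_path min_path_take min_path_search_path by blast

section \<open>Bases and blossoms\<close>

definition last_above :: "enat \<Rightarrow> 'a list \<Rightarrow> nat \<Rightarrow> bool" where
  "last_above N p i \<longleftrightarrow>
     i < length p \<and> N < \<tau> (p ! i) \<and> (\<forall>j < length p. N < \<tau> (p ! j) \<longrightarrow> j \<le> i)"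

lemma
  assumes "last_above N p i"
  shows last_above_less_length: "i < length p" and last_above_tenacity: "N < \<tau> (p ! i)"
    and last_above_greatest: "j < length p \<Longrightarrow> N < \<tau> (p ! j) \<Longrightarrow> j \<le> i"
  using assms unfolding last_above_def by auto

lemma furthest_of_higher_tenacity_iff:
  "furthest_of_higher_tenacity V E M N p b \<longleftrightarrow> (\<exists>i. last_above N p i \<and> p ! i = b)"
  unfolding furthest_of_higher_tenacity_def last_above_def by blast

lemma last_above_unique: "last_above N p i \<Longrightarrow> last_above N p j \<Longrightarrow> i = j"
  unfolding last_above_def by (auto intro!: order_antisym)

lemma tenacity_start: "search_path p \<Longrightarrow> min_aug \<le> \<tau> (p ! 0)"
  using tenacity_unmatched_ge search_path_start by blast

lemma last_above_exists:
  assumes p: "search_path p" and N: "N < min_aug"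
  obtains i where "last_above N p i"
proof -
  let ?A = "{j. j < length p \<and> N < \<tau> (p ! j)}"
  have "0 \<in> ?A" "finite ?A"
    using order.strict_trans2[OF N tenacity_start[OF p]] search_path_nonempty[OF p] by auto
  then have "Max ?A \<in> ?A" "\<forall>j\<in>?A. j \<le> Max ?A" using Max_in[of ?A] Max_ge[of ?A] by blast+
  then show ?thesis using that[of "Max ?A"] unfolding last_above_def by blast
qed

lemma last_above_take:
  assumes "last_above N p i" "i < k"
  shows "last_above N (take k p) i"
  using assms unfolding last_above_def by auto

lemma last_above_less_path_length:
  assumes p: "min_path v p" and v_tenacity: "\<tau> v \<le> N" and h: "last_above N p h"
  shows "h < path_length p"
proof -
  have "p ! h \<noteq> v" using last_above_tenacity[OF h] v_tenacity by auto
  then have "h \<noteq> path_length p" using min_path_nth_eq_iff[OF p last_above_less_length[OF h]] by simp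
  then show ?thesis using last_above_less_length[OF h] min_path_length[OF p] by simp
qed

lemma last_above_even:
  assumes p: "search_path p" and h: "last_above N p h" "h < path_length p"
  shows "even h"
proof (rule ccontr)
  have Suc_less: "Suc h < length p" using h(2) search_path_length[OF p] by simp
  assume "odd h"
  then have "{p ! h, p ! Suc h} \<in> M" using search_path_matched_iff[OF p Suc_less] by simp
  then have "N < \<tau> (p ! Suc h)" using tenacity_mate last_above_tenacity[OF h(1)] by metis
  then show False using last_above_greatest[OF h(1) Suc_less] by simp
qed

definition well_based :: "'a \<Rightarrow> bool" where
  "well_based v \<longleftrightarrow>
     (\<forall>p. min_path v p \<longrightarrow> furthest_of_higher_tenacity V E M (\<tau> v) p (base V E M v))"

definition based_below :: "nat \<Rightarrow> bool" where
  "based_below N \<longleftrightarrow> (\<forall>v. \<tau> v < enat N \<longrightarrow> well_based v)"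

lemma well_basedI:
  assumes p: "min_path v p"
    and b: "\<And>q. min_path v q \<Longrightarrow> furthest_of_higher_tenacity V E M (\<tau> v) q b"
  shows "well_based v"
proof -
  have "base V E M v = b"
    unfolding base_def min_path_def[symmetric]
    using b p last_above_unique unfolding furthest_of_higher_tenacity_iff
    by (intro the_equality) blast+
  then show ?thesis using b unfolding well_based_def by simp
qed

lemma well_basedE:
  assumes "well_based v" "min_path v p"
  obtains i where "last_above (\<tau> v) p i" "p ! i = base V E M v"
  using assms unfolding well_based_def furthest_of_higher_tenacity_iff by blast

lemma tenacity_base:
  assumes "well_based v" "\<tau> v \<noteq> \<infinity>"
  shows "\<tau> v < \<tau> (base V E M v)"
proof -
  obtain p where p: "min_path v p" using level_finite[OF assms(2)] by (rule min_path_exists)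
  show ?thesis using well_basedE[OF assms(1) p] last_above_tenacity by metis
qed

lemma base_of_high_tenacity_mem:
  assumes p: "min_path v p" and finite_tenacity: "\<tau> v \<noteq> \<infinity>"
    and u: "u \<in> set p" "\<tau> v \<le> \<tau> u" "well_based u"
  shows "base V E M u \<in> set p"
proof -
  obtain k where k: "k < length p" "p ! k = u" using u(1) by (auto simp: in_set_conv_nth)
  have "min_path u (take (Suc k) p)"
    using min_path_prefix[OF p finite_tenacity k(1)] k(2) u(2) by simp
  then obtain i where "last_above (\<tau> u) (take (Suc k) p) i" "take (Suc k) p ! i = base V E M u"
    by (rule well_basedE[OF u(3)])
  then have "base V E M u \<in> set (take (Suc k) p)" using last_above_less_length nth_mem by metis
  then show ?thesis by (rule in_set_takeD)
qed

lemma base_mate: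
  assumes mates: "{x, y} \<in> M" and well_based: "well_based x" "well_based y"
    and finite_tenacity: "\<tau> x \<noteq> \<infinity>"
  shows "base V E M x = base V E M y"
proof -
  have y_tenacity: "\<tau> y = \<tau> x" using tenacity_mate[OF mates] by simp
  obtain p where p: "min_path x p" and even: "even (path_length p)"
    using min_paths_exist[OF finite_tenacity] .
  obtain k where k: "path_length p = Suc k" "p ! k = y"
    using even_min_path_ends_with_mate[OF p even mates] .
  then have k_less: "k < length p" using min_path_length[OF p] by simp
  have "min_path y (take (Suc k) p)"
    using min_path_prefix[OF p finite_tenacity k_less] k(2) y_tenacity by simp
  then obtain i where i: "last_above (\<tau> y) (take (Suc k) p) i" "take (Suc k) p ! i = base V E M y"
    by (rule well_basedE[OF well_based(2)])
  obtain j where j: "last_above (\<tau> x) p j" "p ! j = base V E M x"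
    using well_basedE[OF well_based(1) p] .
  have "j \<noteq> Suc k" "j \<noteq> k"
    using last_above_tenacity[OF j(1)] min_path_nth_last[OF p] k y_tenacity by auto
  then have j_less: "j < Suc k"
    using last_above_less_length[OF j(1)] k(1) min_path_length[OF p] by simp
  then have "i = j" using last_above_unique[OF i(1)] last_above_take[OF j(1)] y_tenacity by simp
  then show ?thesis using i(2) j(2) j_less by simp
qed

primrec blossom_base :: "nat \<Rightarrow> 'a \<Rightarrow> 'a" where
  "blossom_base 0 x = x"
| "blossom_base (Suc s) x =
     (if \<tau> (blossom_base s x) = enat (Suc s) then base V E M (blossom_base s x)
      else blossom_base s x)"

lemma tenacity_blossom_base: "based_below N \<Longrightarrow> s < N \<Longrightarrow> enat s < \<tau> (blossom_base s x)"
proof (induction s)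
  case 0
  then show ?case using tenacity_pos by (simp add: zero_enat_def)
next
  case (Suc s)
  show ?case
  proof (cases "\<tau> (blossom_base s x) = enat (Suc s)")
    case True
    then have "well_based (blossom_base s x)" using Suc.prems unfolding based_below_def by simp
    from tenacity_base[OF this] True show ?thesis by simp
  next
    case False
    then show ?thesis using enat_Suc_less Suc by simp
  qed
qed

lemma blossom_base_eq_self: "enat s < \<tau> x \<Longrightarrow> blossom_base s x = x"
proof (induction s)
  case (Suc s)
  then have "enat s < \<tau> x" by (metis enat_ord_simps(2) lessI less_trans)
  then show ?case using Suc by auto
qed simp

lemma blossom_base_eq_mono:
  assumes "blossom_base s x = blossom_base s y" "s \<le> s'"
  shows "blossom_base s' x = blossom_base s' y"
  using assms(2,1) by (induction rule: dec_induct) auto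

lemma blossom_base_at_tenacity:
  assumes "\<tau> x = enat n"
  shows "blossom_base n x = base V E M x"
proof (cases n)
  case 0
  then show ?thesis using assms tenacity_pos[of x] by (simp add: zero_enat_def)
next
  case (Suc m)
  then show ?thesis using assms blossom_base_eq_self[of m x] by simp
qed

lemma blossom_base_mate:
  assumes based: "based_below N" "s < N" and mates: "{x, y} \<in> M" and x_tenacity: "\<tau> x \<le> enat s"
  shows "blossom_base s x = blossom_base s y"
proof -
  obtain n where n: "\<tau> x = enat n" "n \<le> s" using x_tenacity by (cases "\<tau> x") auto
  then have y_tenacity: "\<tau> y = enat n" using tenacity_mate[OF mates] by simp
  have "well_based x" "well_based y" using based n y_tenacity unfolding based_below_def by auto
  then have "blossom_base n x = blossom_base n y"
    using base_mate[OF mates] n y_tenacity by (simp add: blossom_base_at_tenacity)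
  then show ?thesis using blossom_base_eq_mono n(2) by blast
qed

section \<open>Tight paths\<close>

definition tight :: "nat \<Rightarrow> 'a list \<Rightarrow> bool" where
  "tight s p \<longleftrightarrow> blossom_base s (last p) \<in> set p \<and>
     (\<forall>i. Suc i < length p \<longrightarrow> blossom_base s (p ! i) \<noteq> blossom_base s (p ! Suc i) \<longrightarrow>
        blossom_base s (p ! i) \<in> set (take (Suc i) p) \<and>
        blossom_base s (p ! Suc i) \<notin> set (take (Suc i) p))"

lemma tight_blossom_base_mem:
  assumes tight: "tight s p" and u: "u \<in> set p"
  shows "blossom_base s u \<in> set p"
proof -
  have nonempty: "p \<noteq> []" using u by auto
  obtain i where i: "i < length p" "p ! i = u" using u by (auto simp: in_set_conv_nth)
  then have "i \<le> path_length p" unfolding path_length_def by simp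
  then have "blossom_base s (p ! i) \<in> set p"
  proof (induction rule: inc_induct)
    case base
    show ?case using tight nth_path_length[OF nonempty] unfolding tight_def by simp
  next
    case (step n)
    show ?case
    proof (cases "blossom_base s (p ! n) = blossom_base s (p ! Suc n)")
      case False
      moreover have "Suc n < length p" using step(2) path_length_conv[OF nonempty] by simp
      ultimately have "blossom_base s (p ! n) \<in> set (take (Suc n) p)"
        using tight unfolding tight_def by blast
      then show ?thesis by (rule in_set_takeD)
    qed (use step in simp)
  qed
  then show ?thesis using i(2) by simp
qed

lemma tight_contiguous:
  assumes tight: "tight s p" and k: "i \<le> k" "k \<le> j" "j < length p"
    and same_blossom: "blossom_base s (p ! i) = blossom_base s (p ! j)"
  shows "blossom_base s (p ! k) = blossom_base s (p ! i)"
proof (rule ccontr)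
  let ?b = "blossom_base s (p ! i)"
  assume left: "blossom_base s (p ! k) \<noteq> ?b"
  obtain m where m: "m < k" "blossom_base s (p ! m) = ?b" "blossom_base s (p ! Suc m) \<noteq> ?b"
    using nat_change_point[of i k "\<lambda>m. blossom_base s (p ! m) = ?b"] k(1) left by blast
  obtain n where n: "k \<le> n" "n < j" "blossom_base s (p ! n) \<noteq> ?b" "blossom_base s (p ! Suc n) = ?b"
    using nat_change_point[of k j "\<lambda>m. blossom_base s (p ! m) \<noteq> ?b"] k(2) left same_blossom by force
  have "Suc m < length p" "Suc n < length p" using m n k by linarith+
  then have "?b \<in> set (take (Suc m) p)" "?b \<notin> set (take (Suc n) p)"
    using tight m n unfolding tight_def by metis+
  moreover have "set (take (Suc m) p) \<subseteq> set (take (Suc n) p)"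
    using m(1) n(1) by (intro set_take_subset_set_take) simp
  ultimately show False by blast
qed

lemma tight_blossom_base_index_ge:
  assumes tight: "tight s p" and p: "distinct p" and k: "h \<le> k" "k < length p"
    and h: "enat s < \<tau> (p ! h)" and b: "b < length p" "p ! b = blossom_base s (p ! k)"
      "enat s < \<tau> (p ! b)"
  shows "h \<le> b"
proof (rule ccontr)
  assume less: "\<not> h \<le> b"
  then have "blossom_base s (p ! h) = p ! b"
    using tight_contiguous[OF tight, of b h k] k b blossom_base_eq_self by simp
  then have "p ! h = p ! b" using blossom_base_eq_self[OF h] by simp
  then show False using less k b(1) nth_eq_iff_index_eq[OF p] by simp
qed

text \<open>An even path ends with a matched edge, and the mate of the base of a blossom lies outside it.\<close>

lemma tight_ending_at_base_odd:
  assumes p: "search_path p" and tight: "tight s p" and k: "k < path_length p"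
    and base_last: "blossom_base s (p ! k) = last p" and above: "enat s < \<tau> (last p)"
  shows "odd (path_length p)"
proof
  assume even: "even (path_length p)"
  obtain l where l: "path_length p = Suc l" using k by (cases "path_length p") auto
  then have "{p ! l, last p} \<in> M"
    using search_path_matched_iff[OF p, of l] search_path_length[OF p] search_path_nth_last[OF p]
      even
    by simp
  then have "enat s < \<tau> (p ! l)" using tenacity_mate above by metis
  then have "p ! l = last p"
    using tight_contiguous[OF tight, of k l "Suc l"] k base_last l search_path_length[OF p]
      search_path_nth_last[OF p] above
    by (simp add: blossom_base_eq_self)
  then show False
    using search_path_distinct[OF p] search_path_length[OF p] l nth_eq_iff_index_eq[of p l "Suc l"]
    by (simp flip: search_path_nth_last[OF p])
qed

text \<open>The excess is the number of matched minus the number of unmatched edges among the first \<open>i\<close>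
  edges of \<open>p\<close> that lie inside a blossom of level \<open>s\<close>. Its correction \<open>slack\<close> is nondecreasing along
  the path; it grows exactly when a blossom is left without having visited its base, or entered
  after its base was visited.\<close>

definition excess :: "nat \<Rightarrow> 'a list \<Rightarrow> nat \<Rightarrow> int" where
  "excess s p i = (\<Sum>j<i.
     if blossom_base s (p ! j) = blossom_base s (p ! Suc j) then (if even j then -1 else 1) else 0)"

definition slack :: "nat \<Rightarrow> 'a list \<Rightarrow> nat \<Rightarrow> int" where
  "slack s p i =
     (if even i then excess s p i - of_bool (blossom_base s (p ! i) \<notin> set (take (Suc i) p))
      else excess s p i + of_bool (blossom_base s (p ! i) \<in> set (take i p)))"

definition min_excess :: "nat \<Rightarrow> 'a list \<Rightarrow> int" where
  "min_excess s p = - of_bool (odd (path_length p) \<and> \<tau> (last p) \<le> enat s)"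

lemma slack_Suc:
  assumes based: "based_below N" "s < N" and p: "search_path p" and i: "Suc i < length p"
  shows "slack s p (Suc i) = slack s p i +
    (if blossom_base s (p ! i) = blossom_base s (p ! Suc i) then 0
     else of_bool (blossom_base s (p ! i) \<notin> set (take (Suc i) p)) +
          of_bool (blossom_base s (p ! Suc i) \<in> set (take (Suc i) p)))"
proof (cases "even i")
  case True
  then show ?thesis unfolding slack_def excess_def by auto
next
  case odd: False
  have mates: "{p ! i, p ! Suc i} \<in> M" using search_path_matched_iff[OF p i] odd by simp
  have notin: "p ! i \<notin> set (take i p)" "p ! Suc i \<notin> set (take (Suc i) p)"
    using nth_notin_set_take[OF search_path_distinct[OF p]] i by auto
  have sets: "set (take (Suc i) p) = insert (p ! i) (set (take i p))"
    "set (take (Suc (Suc i)) p) = insert (p ! Suc i) (insert (p ! i) (set (take i p)))"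
    using i by (auto simp: set_take_Suc)
  show ?thesis
  proof (cases "\<tau> (p ! i) \<le> enat s")
    case True
    have "blossom_base s (p ! i) = blossom_base s (p ! Suc i)"
      using blossom_base_mate[OF based mates True] .
    moreover have "blossom_base s (p ! i) \<noteq> p ! i" "blossom_base s (p ! i) \<noteq> p ! Suc i"
      using tenacity_blossom_base[OF based, of "p ! i"] True tenacity_mate[OF mates] by auto
    ultimately show ?thesis using odd sets unfolding slack_def excess_def by auto
  next
    case False
    then have "blossom_base s (p ! i) = p ! i" "blossom_base s (p ! Suc i) = p ! Suc i"
      using blossom_base_eq_self tenacity_mate[OF mates] by auto
    then show ?thesis using odd sets notin unfolding slack_def excess_def by auto
  qed
qed

lemma slack_mono:
  assumes based: "based_below N" "s < N" and p: "search_path p" and order: "i \<le> j" "j < length p"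
  shows "slack s p i \<le> slack s p j"
  using order
proof (induction rule: dec_induct)
  case (step k)
  then show ?case using slack_Suc[OF based p, of k] by auto
qed simp

lemma slack_0:
  assumes p: "search_path p" and s: "enat s < min_aug"
  shows "slack s p 0 = 0"
  using order.strict_trans2[OF s tenacity_start[OF p]] search_path_nonempty[OF p]
  unfolding slack_def excess_def by (simp add: blossom_base_eq_self set_take_Suc)

lemma excess_path_length:
  assumes based: "based_below N" "s < N" and p: "search_path p"
  shows "excess s p (path_length p) =
    min_excess s p + slack s p (path_length p) + of_bool (blossom_base s (last p) \<notin> set p)"
proof -
  let ?L = "path_length p" and ?b = "blossom_base s (last p)"
  have L_less: "?L < length p" using search_path_length[OF p] by simp
  have set_p: "set p = insert (last p) (set (take ?L p))"
    using set_take_Suc[OF L_less] search_path_length[OF p] search_path_nth_last[OF p] by simp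
  have notin: "last p \<notin> set (take ?L p)"
    using nth_notin_set_take[OF search_path_distinct[OF p] L_less] search_path_nth_last[OF p]
    by simp
  show ?thesis
  proof (cases "\<tau> (last p) \<le> enat s")
    case True
    then have "?b \<noteq> last p" using tenacity_blossom_base[OF based, of "last p"] by auto
    then show ?thesis
      using True set_p search_path_length[OF p] search_path_nth_last[OF p]
      unfolding min_excess_def slack_def by simp
  next
    case False
    then have "?b = last p" by (simp add: blossom_base_eq_self)
    then show ?thesis
      using False set_p notin search_path_length[OF p] search_path_nth_last[OF p]
      unfolding min_excess_def slack_def by simp
  qed
qed

lemma slack_path_length_nonneg:
  assumes "based_below N" "s < N" "search_path p" "enat N \<le> min_aug"
  shows "0 \<le> slack s p (path_length p)"
proof -
  have "enat s < min_aug" using assms(2,4) by (meson enat_ord_simps(2) order.strict_trans2)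
  then show ?thesis
    using slack_mono[OF assms(1-3), of 0 "path_length p"] slack_0[OF assms(3)]
      search_path_length[OF assms(3)]
    by simp
qed

lemma min_excess_le_excess:
  assumes "based_below N" "s < N" "search_path p" "enat N \<le> min_aug"
  shows "min_excess s p \<le> excess s p (path_length p)"
  using excess_path_length[OF assms(1-3)] slack_path_length_nonneg[OF assms] by simp

lemma tight_if_min_excess:
  assumes based: "based_below N" "s < N" and p: "search_path p" and aug: "enat N \<le> min_aug"
    and attained: "excess s p (path_length p) = min_excess s p"
  shows "tight s p"
proof -
  have length: "length p = Suc (path_length p)" using search_path_length[OF p] .
  have "0 \<le> slack s p (path_length p)" using slack_path_length_nonneg[OF based p aug] .
  then have last: "blossom_base s (last p) \<in> set p" and slack_last: "slack s p (path_length p) = 0"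
    using excess_path_length[OF based p] attained by (auto simp: of_bool_def split: if_splits)
  have "enat s < min_aug" using based(2) aug by (meson enat_ord_simps(2) order.strict_trans2)
  then have slack_start: "slack s p 0 = 0" using slack_0[OF p] by simp
  show ?thesis unfolding tight_def
  proof (intro conjI allI impI last)
    fix i
    assume i: "Suc i < length p"
      and change: "blossom_base s (p ! i) \<noteq> blossom_base s (p ! Suc i)"
    have "0 \<le> slack s p i" "slack s p (Suc i) \<le> 0"
      using slack_mono[OF based p, of 0 i] slack_mono[OF based p, of "Suc i" "path_length p"] i
        length
        slack_start slack_last by auto
    then show "blossom_base s (p ! i) \<in> set (take (Suc i) p)"
      "blossom_base s (p ! Suc i) \<notin> set (take (Suc i) p)"
      using slack_Suc[OF based p i] change by (auto simp: of_bool_def split: if_splits)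
  qed
qed

section \<open>The dual certificate\<close>

text \<open>Scaled by 2, so that time \<open>N / 2\<close> causes no fractions. The three cases are outer, inner and
  unreached vertices. In the first two the level that is used is finite, so that \<open>the_enat\<close> is
  meaningful.\<close>

definition potential :: "nat \<Rightarrow> 'a \<Rightarrow> int" where
  "potential N x =
    (if \<tau> x < enat N \<or> level True x + level True x < enat N
       then 2 * int (the_enat (level True x)) - int N
     else if level False x + level False x < enat N
       then int N - 2 * int (the_enat (level False x))
     else 0)"

definition common_blossoms :: "nat \<Rightarrow> 'a \<Rightarrow> 'a \<Rightarrow> nat" where
  "common_blossoms N x y = card {s. s < N \<and> blossom_base s x = blossom_base s y}"

definition feasible :: "nat \<Rightarrow> bool" where
  "feasible N \<longleftrightarrow> (\<forall>x y. {x, y} \<in> E \<longrightarrow> {x, y} \<notin> M \<longrightarrow>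
     - 2 \<le> potential N x + potential N y + 2 * int (common_blossoms N x y))"

lemma potential_outer:
  assumes e: "level True x = enat e" and outer: "\<tau> x \<le> enat N \<or> 2 * e < N"
  shows "potential N x = 2 * int e - int N"
proof (cases "\<tau> x < enat N \<or> 2 * e < N")
  case True
  then show ?thesis using e unfolding potential_def by auto
next
  case False
  then have boundary: "\<tau> x = enat N" "N \<le> 2 * e" using outer by auto
  then obtain d where "level False x = enat d" "e + d = N"
    using e unfolding tenacity_eq_levels[of x True] by (cases "level False x") auto
  then show ?thesis using boundary e unfolding potential_def by auto
qed

lemma common_blossoms_mate:
  assumes based: "based_below N" and mates: "{x, y} \<in> M"
  shows "common_blossoms N x y = card {s. s < N \<and> \<tau> x \<le> enat s}"
proof -
  have "blossom_base s x = blossom_base s y \<longleftrightarrow> \<tau> x \<le> enat s" if "s < N" for s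
  proof (cases "\<tau> x \<le> enat s")
    case True
    then show ?thesis using blossom_base_mate[OF based that mates] by simp
  next
    case False
    then show ?thesis
      using edge_distinct[OF matched_edge[OF mates]] tenacity_mate[OF mates]
      by (simp add: blossom_base_eq_self)
  qed
  then show ?thesis unfolding common_blossoms_def by (metis (lifting))
qed

lemma potential_mate_le:
  assumes based: "based_below N" and mates: "{x, y} \<in> M"
  shows "potential N x + potential N y + 2 * int (common_blossoms N x y) \<le> 2"
proof (cases "\<tau> x < enat N")
  case True
  then obtain n where n: "\<tau> x = enat n" "n < N" by (cases "\<tau> x") auto
  have y_tenacity: "\<tau> y = enat n" using tenacity_mate[OF mates] n by simp
  have "{s. s < N \<and> \<tau> x \<le> enat s} = {n..<N}" using n by auto
  then have "common_blossoms N x y = N - n" using common_blossoms_mate[OF based mates] by simp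
  moreover obtain e1 e2 where levels: "level True x = enat e1" "level True y = enat e2"
    using level_finite[of x True] level_finite[of y True] n y_tenacity by auto
  moreover have "e1 + e2 = Suc n"
    using n(1) level_even_mate[of y x] mates levels unfolding tenacity_eq_levels[of x True]
    by (cases "level False x") (auto simp: insert_commute one_enat_def)
  ultimately show ?thesis
    using potential_outer[of x e1 N] potential_outer[of y e2 N] n y_tenacity by auto
next
  case False
  then have "{s. s < N \<and> \<tau> x \<le> enat s} = {}"
    by (auto simp: not_less) (meson enat_ord_simps(1) not_less order_trans)
  then have "common_blossoms N x y = 0" using common_blossoms_mate[OF based mates] by simp
  moreover have "level True x = level False y + 1" "level True y = level False x + 1"
    using level_even_mate[OF mates] level_even_mate[of y x] mates by (auto simp: insert_commute)
  ultimately show ?thesis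
    using False tenacity_mate[OF mates] unfolding potential_def tenacity_eq_levels[of _ True]
    by (cases "level False x"; cases "level False y") (auto simp: one_enat_def)
qed

lemma sum_excess_Suc:
  "(\<Sum>s<N. excess s p (Suc i)) = (\<Sum>s<N. excess s p i) +
     (if even i then -1 else 1) * int (common_blossoms N (p ! i) (p ! Suc i))"
proof -
  let ?same = "\<lambda>s. blossom_base s (p ! i) = blossom_base s (p ! Suc i)"
  define c :: int where "c = (if even i then -1 else 1)"
  have "(\<Sum>s<N. if ?same s then c else 0) = (\<Sum>s | s < N \<and> ?same s. c)"
    by (rule sum.mono_neutral_cong_right) auto
  also have "\<dots> = c * int (common_blossoms N (p ! i) (p ! Suc i))"
    unfolding common_blossoms_def by simp
  finally show ?thesis unfolding excess_def c_def by (simp add: sum.distrib)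
qed

text \<open>The edge constraints along the path, added with alternating signs.\<close>

lemma length_ge_potential:
  assumes based: "based_below N" and feasible: "feasible N"
    and p: "search_path p" and i: "i < length p"
  shows "int N + (if even i then potential N (p ! i) else - potential N (p ! i))
           + 2 * (\<Sum>s<N. excess s p i) \<le> 2 * int i"
  using i
proof (induction i)
  case 0
  have "level True (p ! 0) = 0" using level_even_unmatched search_path_start[OF p] by blast
  then show ?case by (simp add: excess_def potential_def zero_enat_def)
next
  case (Suc i)
  let ?x = "p ! i" and ?y = "p ! Suc i"
  have IH: "int N + (if even i then potential N ?x else - potential N ?x)
           + 2 * (\<Sum>s<N. excess s p i) \<le> 2 * int i" using Suc by simp
  note edge = search_path_edge[OF p Suc.prems] search_path_matched_iff[OF p Suc.prems]
  show ?case
  proof (cases "even i")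
    case True
    then have "- 2 \<le> potential N ?x + potential N ?y + 2 * int (common_blossoms N ?x ?y)"
      using edge feasible unfolding feasible_def by blast
    then show ?thesis using IH True unfolding sum_excess_Suc by simp
  next
    case False
    then have "potential N ?x + potential N ?y + 2 * int (common_blossoms N ?x ?y) \<le> 2"
      using edge potential_mate_le[OF based] by blast
    then show ?thesis using IH False unfolding sum_excess_Suc by simp
  qed
qed

lemma sum_min_excess:
  assumes "\<tau> (last p) = enat n" "n \<le> N"
  shows "(\<Sum>s<N. min_excess s p) = (if odd (path_length p) then - int (N - n) else 0)"
proof -
  have "{s. s < N \<and> n \<le> s} = {n..<N}" by auto
  then show ?thesis
    using assms
    by (auto simp: min_excess_def sum_negf of_bool_def sum.If_cases Int_def lessThan_def)
qed

lemma min_path_tight: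
  assumes based: "based_below N" and feasible: "feasible N" and aug: "enat N \<le> min_aug"
    and p: "min_path v p" and v_tenacity: "\<tau> v \<le> enat N" and s: "s < N"
  shows "tight s p"
proof -
  note p_path = min_path_search_path[OF p]
  let ?L = "path_length p"
  obtain n where n: "\<tau> v = enat n" "n \<le> N" using v_tenacity by (cases "\<tau> v") auto
  obtain e where e: "level True v = enat e" using level_finite[of v True] n by auto
  have "potential N v = 2 * int e - int N" using potential_outer[OF e] v_tenacity by blast
  moreover have "int N + (if even ?L then potential N v else - potential N v)
           + 2 * (\<Sum>s<N. excess s p ?L) \<le> 2 * int ?L"
    using length_ge_potential[OF based feasible p_path, of ?L] min_path_length[OF p]
    unfolding min_path_nth_last[OF p] by simp
  moreover have "int ?L = (if even ?L then int e else int n - int e)"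
    using min_path_level[OF p] e n(1) unfolding tenacity_eq_levels[of v True] by auto
  ultimately have sum_le: "(\<Sum>s<N. excess s p ?L) \<le> (\<Sum>s<N. min_excess s p)"
    using sum_min_excess[of p n N] min_path_last[OF p] n by (auto split: if_splits)
  have excess_ge: "min_excess s p \<le> excess s p ?L" if "s \<in> {..<N}" for s
    using min_excess_le_excess[OF based _ p_path aug] that by simp
  have "(\<Sum>s<N. min_excess s p) = (\<Sum>s<N. excess s p ?L)"
    using sum_mono[OF excess_ge] sum_le by (rule order_antisym)
  then have "min_excess s p = excess s p ?L"
    using sum_mono_inv[of _ "{..<N}"] excess_ge s by blast
  then show ?thesis using tight_if_min_excess[OF based s p_path aug] by simp
qed

section \<open>Independence of the base from the path\<close>

definition min_paths_tight :: "nat \<Rightarrow> bool" where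
  "min_paths_tight N \<longleftrightarrow> (\<forall>v p s. min_path v p \<longrightarrow> \<tau> v \<le> enat N \<longrightarrow> s < N \<longrightarrow> tight s p)"

definition min_level :: "'a \<Rightarrow> enat" where
  "min_level v = min (level True v) (level False v)"

lemma min_level_le: "min_level v \<le> level ev v"
  unfolding min_level_def by (cases ev) auto

lemma min_level_eq_path_lengths:
  assumes "min_path v p" "min_path v r" "even (path_length p) \<noteq> even (path_length r)"
  shows "min_level v = enat (min (path_length p) (path_length r))"
  using min_path_level[OF assms(1)] min_path_level[OF assms(2)] assms(3)
  unfolding min_level_def by (cases "even (path_length p)") (auto simp: min.commute)

context
  fixes N v p r
  assumes tenacity: "\<tau> v = enat N" and p: "min_path v p" and r: "min_path v r"
    and opposite: "even (path_length p) \<noteq> even (path_length r)"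
begin

lemma opposite_path_lengths: "N = path_length p + path_length r"
  using tenacity_eq_path_lengths[OF p r opposite] tenacity by simp

lemma common_vertex_same_parity:
  assumes k: "k < length p" and j: "j < length r" and meet: "p ! k = r ! j"
    and above: "enat N \<le> \<tau> (p ! k)" and not_end: "p ! k \<noteq> v"
  shows "even k = even j"
proof (rule ccontr)
  note p_path = min_path_search_path[OF p] and r_path = min_path_search_path[OF r]
  assume "even k \<noteq> even j"
  then have "\<tau> (p ! k) = level (even k) (p ! k) + level (even j) (p ! k)"
    using tenacity_eq_levels[of "p ! k" "even k"] by simp
  also have "\<dots> \<le> enat k + enat j"
    using level_nth_le[OF p_path k] level_nth_le[OF r_path j] meet by (intro add_mono) auto
  finally have "N \<le> k + j" using above by (metis order_trans plus_enat_simps(1) enat_ord_simps(1))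
  then have "k = path_length p"
    using opposite_path_lengths k j min_path_length[OF p] min_path_length[OF r] by simp
  then show False using not_end min_path_nth_last[OF p] by simp
qed

lemma min_level_common_vertex_less:
  assumes k: "k < length p" and j: "j < length r" and meet: "p ! k = r ! j"
    and parity: "even k = even j"
  shows "min_level (p ! k) < min_level v"
proof -
  note ends = min_path_nth_eq_iff[OF p k] min_path_nth_eq_iff[OF r j]
  have "p ! k \<noteq> v" using ends meet parity opposite by auto
  then have "k < path_length p" "j < path_length r"
    using ends k j meet min_path_length[OF p] min_path_length[OF r] by auto
  moreover have "min_level (p ! k) \<le> enat k" "min_level (p ! k) \<le> enat j"
    using min_level_le[of "p ! k" "even k"] level_nth_le[OF min_path_search_path[OF p] k]
      level_nth_le[OF min_path_search_path[OF r] j] parity meet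
    by (auto intro: order_trans)
  ultimately show ?thesis
    unfolding min_level_eq_path_lengths[OF p r opposite] by (cases "min_level (p ! k)") auto
qed

lemma last_above_index_le_if_mem:
  assumes i: "last_above (enat N) p i" and j: "last_above (enat N) r j" and mem: "p ! i \<in> set r"
  shows "i \<le> j \<and> p ! i = r ! i"
proof -
  have finite_tenacity: "\<tau> v \<noteq> \<infinity>" and not_end: "p ! i \<noteq> v"
    using last_above_tenacity[OF i] tenacity by auto
  obtain k where k: "k < length r" "p ! i = r ! k" using mem unfolding in_set_conv_nth by auto
  have parity: "even i = even k"
    using common_vertex_same_parity[OF last_above_less_length[OF i] k _ not_end]
      last_above_tenacity[OF i]
    by simp
  have "\<tau> v \<le> \<tau> (p ! i)" using last_above_tenacity[OF i] tenacity by simp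
  then have "level (even i) (p ! i) = enat i" "level (even i) (p ! i) = enat k"
    using level_nth_min_path[OF p finite_tenacity last_above_less_length[OF i]]
      level_nth_min_path[OF r finite_tenacity k(1)]
    unfolding parity k(2) by auto
  then have "i = k" by simp
  then show ?thesis using k last_above_greatest[OF j k(1)] last_above_tenacity[OF i] by simp
qed

lemma blossom_base_neq_end:
  assumes k: "k < length p" and j: "j < length r" and meet: "p ! k = r ! j" and not_end: "p ! k \<noteq> v"
    and tight: "tight s p" "tight s r" and above: "enat s < \<tau> v"
  shows "blossom_base s (p ! k) \<noteq> v"
proof
  note p_path = min_path_search_path[OF p] and r_path = min_path_search_path[OF r]
  assume base: "blossom_base s (p ! k) = v"
  have "k < path_length p" "j < path_length r"
    using k j not_end meet min_path_nth_eq_iff[OF p k] min_path_nth_eq_iff[OF r j]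
      min_path_length[OF p] min_path_length[OF r] by auto
  then have "odd (path_length p)" "odd (path_length r)"
    using tight_ending_at_base_odd[OF p_path tight(1), of k]
      tight_ending_at_base_odd[OF r_path tight(2), of j]
      base above meet min_path_last[OF p] min_path_last[OF r] by auto
  then show False using opposite by simp
qed

context
  assumes based: "based_below N" and tight: "min_paths_tight N"
begin

lemma same_parity_blossom_base:
  assumes k: "h \<le> k" "k < length p" and j: "j < length r" and meet: "p ! k = r ! j"
    and h: "last_above (enat N) p h" and below: "\<tau> (p ! k) < enat N"
  obtains k' j' where "h \<le> k'" "k' < length p" "j' < length r" "p ! k' = r ! j'"
    "even k' = even j'" "enat N \<le> \<tau> (p ! k')"
proof -
  note p_path = min_path_search_path[OF p]
  have "N \<noteq> 0" using below by (metis zero_enat_def not_less_zero)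
  then obtain n where n: "N = Suc n" by (cases N) auto
  have tight_n: "tight n p" "tight n r"
    using tight p r tenacity n unfolding min_paths_tight_def by auto
  define b where "b = blossom_base n (p ! k)"
  have above: "enat n < \<tau> b" "enat N \<le> \<tau> b"
    using tenacity_blossom_base[OF based] n unfolding b_def by (simp_all add: Suc_ile_eq)
  have "b \<in> set p" "b \<in> set r"
    using tight_blossom_base_mem[OF tight_n(1) nth_mem[OF k(2)]]
      tight_blossom_base_mem[OF tight_n(2) nth_mem[OF j]] meet unfolding b_def by auto
  then obtain k' j' where k': "k' < length p" "p ! k' = b" and j': "j' < length r" "r ! j' = b"
    unfolding in_set_conv_nth by blast
  have "enat n < \<tau> (p ! h)"
    using last_above_tenacity[OF h] n by (metis enat_ord_simps(2) lessI less_trans)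
  then have "h \<le> k'"
    using tight_blossom_base_index_ge[OF tight_n(1) search_path_distinct[OF p_path] k _ k'(1)]
      k'(2) above(1) unfolding b_def by simp
  moreover have "p ! k \<noteq> v" "enat n < \<tau> v" using below tenacity n by auto
  then have "b \<noteq> v" using blossom_base_neq_end[OF k(2) j meet _ tight_n] unfolding b_def by blast
  then have "even k' = even j'"
    using common_vertex_same_parity[OF k'(1) j'(1)] k'(2) j'(2) above(2) by simp
  ultimately show ?thesis using that k' j' above(2) by simp
qed

lemma same_parity_meeting:
  assumes h: "last_above (enat N) p h"
  obtains k j where "h \<le> k" "k < length p" "j < length r" "p ! k = r ! j"
    "even k = even j" "enat N \<le> \<tau> (p ! k)"
proof -
  note p_path = min_path_search_path[OF p] and r_path = min_path_search_path[OF r]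
  note h_less = last_above_less_length[OF h]
  note lengths = min_path_length[OF p] min_path_length[OF r]
  have "path_length r < length r" "r ! path_length r \<in> set (drop h p)"
    using last_in_set_drop[OF h_less] min_path_last[OF p] min_path_nth_last[OF r] lengths by auto
  with p h_less r_path show ?thesis
  proof (cases rule: min_path_first_meeting)
    case (same_parity j k)
    then have j_less: "j < length r" using lengths by simp
    show ?thesis
    proof (cases "\<tau> (p ! k) < enat N")
      case True
      from same_parity_blossom_base[OF same_parity(2,3) j_less same_parity(4)[symmetric] h True]
        that
      show ?thesis by blast
    next
      case False
      then show ?thesis using that[of k j] same_parity j_less by (simp add: not_less)
    qed
  next
    case (opposite_parity j k)
    have "enat N < enat (h + (j + (k - h)))"
      using last_above_tenacity[OF h]
        tenacity_nth_le_if_opposite_level_le[OF p_path h_less opposite_parity(6)]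
      by (rule order.strict_trans2)
    then show ?thesis using opposite_path_lengths opposite_parity(1-3) lengths by simp
  qed
qed

text \<open>Unless the two paths meet at \<open>p ! h\<close> itself, they meet beyond it at a vertex of tenacity \<open>N\<close>, whose
  own base is \<open>p ! h\<close> and by the induction hypothesis lies on both.\<close>

lemma last_above_mem_opposite:
  assumes h: "last_above (enat N) p h"
    and IH: "\<And>z. \<tau> z = enat N \<Longrightarrow> min_level z < min_level v \<Longrightarrow> well_based z"
  shows "p ! h \<in> set r"
proof -
  obtain k j where k: "h \<le> k" "k < length p" and j: "j < length r" and meet: "p ! k = r ! j"
    and parity: "even k = even j" and z_tenacity_ge: "enat N \<le> \<tau> (p ! k)"
    using same_parity_meeting[OF h] .
  show ?thesis
  proof (cases "k = h")
    case True
    then show ?thesis using meet j by simp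
  next
    case False
    define z where "z = p ! k"
    have shorter: "min_level z < min_level v"
      using min_level_common_vertex_less[OF k(2) j meet parity] unfolding z_def .
    have "\<not> enat N < \<tau> z" using last_above_greatest[OF h k(2)] k(1) False unfolding z_def by auto
    then have z_tenacity: "\<tau> z = enat N" using z_tenacity_ge unfolding z_def by simp
    then have well_based: "well_based z" using IH shorter by blast
    have "min_path z (take (Suc k) p)"
      using min_path_prefix[OF p _ k(2)] tenacity z_tenacity unfolding z_def by simp
    then obtain i where i: "last_above (\<tau> z) (take (Suc k) p) i" "take (Suc k) p ! i = base V E M z"
      by (rule well_basedE[OF well_based])
    have "i = h" using last_above_unique[OF i(1)] last_above_take[OF h] k(1) z_tenacity by simp
    then have "p ! h = base V E M z" using i(2) k(1) by simp
    also have "\<dots> \<in> set r"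
      using base_of_high_tenacity_mem[OF r _ _ _ well_based] nth_mem[OF j] meet z_tenacity tenacity
      unfolding z_def by simp
    finally show ?thesis .
  qed
qed

end

end

lemma last_above_eq_opposite:
  assumes based: "based_below N" "min_paths_tight N" and v_tenacity: "\<tau> v = enat N"
    and p: "min_path v p" and r: "min_path v r"
    and opposite: "even (path_length p) \<noteq> even (path_length r)"
    and i: "last_above (enat N) p i" and j: "last_above (enat N) r j"
    and IH: "\<And>z. \<tau> z = enat N \<Longrightarrow> min_level z < min_level v \<Longrightarrow> well_based z"
  shows "p ! i = r ! j"
proof -
  have "p ! i \<in> set r" "r ! j \<in> set p"
    using last_above_mem_opposite[OF v_tenacity p r opposite based i IH]
      last_above_mem_opposite[OF v_tenacity r p opposite[symmetric] based j IH] by blast+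
  then have "i \<le> j \<and> p ! i = r ! i" "j \<le> i"
    using last_above_index_le_if_mem[OF v_tenacity p r opposite i j]
      last_above_index_le_if_mem[OF v_tenacity r p opposite[symmetric] j i] by auto
  then show ?thesis by (metis order_antisym)
qed

lemma well_based_at:
  assumes based: "based_below N" "min_paths_tight N" "enat N < min_aug"
  shows "\<tau> v = enat N \<Longrightarrow> well_based v"
proof (induction "min_level v" arbitrary: v rule: less_induct)
  case less
  have finite_tenacity: "\<tau> v \<noteq> \<infinity>" using less.prems by simp
  obtain p r where p: "min_path v p" "even (path_length p)"
    and r: "min_path v r" "odd (path_length r)"
    using min_paths_exist[OF finite_tenacity] .
  obtain i where i: "last_above (enat N) p i"
    using last_above_exists[OF min_path_search_path[OF p(1)] based(3)] .
  obtain j where j: "last_above (enat N) r j"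
    using last_above_exists[OF min_path_search_path[OF r(1)] based(3)] .
  have IH: "well_based z" if "\<tau> z = enat N" "min_level z < min_level v" for z
    using less.hyps that by blast
  note agree = last_above_eq_opposite[OF based(1,2) less.prems _ _ _ _ _ IH]
  show ?case
  proof (rule well_basedI[OF p(1)])
    fix q assume q: "min_path v q"
    obtain k where k: "last_above (enat N) q k"
      using last_above_exists[OF min_path_search_path[OF q] based(3)] .
    have "p ! i = r ! j" using agree[OF p(1) r(1) _ i j] p(2) r(2) by simp
    then have "q ! k = p ! i"
      using agree[OF q p(1) _ k i] agree[OF q r(1) _ k j] p(2) r(2)
      by (cases "even (path_length q)") auto
    then show "furthest_of_higher_tenacity V E M (\<tau> v) q (p ! i)"
      using k less.prems unfolding furthest_of_higher_tenacity_iff by auto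
  qed
qed

lemma based_below_Suc:
  assumes "based_below N" "min_paths_tight N" "enat N < min_aug"
  shows "based_below (Suc N)"
  unfolding based_below_def
proof (intro allI impI)
  fix v assume "\<tau> v < enat (Suc N)"
  then consider "\<tau> v < enat N" | "\<tau> v = enat N" by (cases "\<tau> v") (auto simp: less_Suc_eq)
  then show "well_based v"
    using assms(1) well_based_at[OF assms] unfolding based_below_def by cases blast+
qed

section \<open>Growing the duals\<close>

lemma potential_sum_ge_if_odd_level_le:
  assumes x: "potential N x = 2 * int e - int N" and y_tenacity: "enat N \<le> \<tau> y"
    and odd_level_le: "level False y \<le> enat (Suc e)"
  shows "- 2 \<le> potential N x + potential N y"
proof -
  obtain d where "level False y = enat d" "d \<le> Suc e"
    using odd_level_le by (cases "level False y") auto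
  then show ?thesis using x y_tenacity unfolding potential_def[of N y] tenacity_eq_levels[of y True]
    by (cases "level True y") auto
qed

lemma potential_nonneg:
  assumes "enat N \<le> \<tau> x" "enat N \<le> level True x + level True x"
  shows "0 \<le> potential N x"
proof -
  have "\<not> \<tau> x < enat N" "\<not> level True x + level True x < enat N"
    using assms by (simp_all add: not_less)
  then show ?thesis unfolding potential_def by (cases "level False x") auto
qed

lemma potential_sum_ge_above:
  assumes edge: "{x, y} \<in> E" "{x, y} \<notin> M" and above: "enat N \<le> \<tau> x" "enat N \<le> \<tau> y"
    and even_level_le: "level True x \<le> level True y"
  shows "- 2 \<le> potential N x + potential N y"
proof (cases "enat N \<le> level True x + level True x")
  case True
  then have "enat N \<le> level True y + level True y"
    using even_level_le by (meson add_mono order_trans)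
  then show ?thesis using potential_nonneg[OF above(1) True] potential_nonneg[OF above(2)] by simp
next
  case False
  then obtain a where a: "level True x = enat a" "2 * a < N" by (cases "level True x") auto
  then obtain p where p: "min_path x p" "even (path_length p)"
    by (metis (full_types) min_path_exists enat.distinct(1))
  note p_path = min_path_search_path[OF p(1)]
  have length: "path_length p = a" using min_path_level[OF p(1)] p(2) a(1) by simp
  have "odd k" if k: "k < length p" "p ! k = y" for k
  proof
    assume "even k"
    then have "level True y \<le> enat k" using level_nth_le[OF p_path k(1)] k(2) by simp
    then have "enat a \<le> enat k" using even_level_le unfolding a(1) by (rule order_trans[rotated])
    then have "k = path_length p" using k(1) length min_path_length[OF p(1)] by simp
    then show False using edge_distinct[OF edge(1)] k(2) min_path_nth_last[OF p(1)] by simp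
  qed
  then have "level False y \<le> enat (Suc a)"
    using level_odd_le_edge[OF p_path p(2), of y] edge min_path_last[OF p(1)]
      min_path_length[OF p(1)] length
    by simp
  then show ?thesis
    using potential_sum_ge_if_odd_level_le potential_outer[OF a(1)] a(2) above(2) by blast
qed

lemma path_length_ge_on_path:
  assumes edge: "{x, y} \<in> E" "{x, y} \<notin> M" and p: "min_path x p" "even (path_length p)"
    and h: "last_above (enat N) p h" and k: "k < h" "even k" "p ! k = y"
  shows "N \<le> path_length p + k"
proof -
  note p_path = min_path_search_path[OF p(1)] and h_less = last_above_less_length[OF h]
  let ?q = "take (Suc k) p"
  have q: "search_path ?q" "last ?q = y" "path_length ?q = k"
    using k h_less search_path_take[OF p_path] by (simp_all add: last_take_Suc path_length_take_Suc)
  have "set ?q \<inter> set (drop h p) = {}"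
    using set_take_disj_set_drop_if_distinct[OF search_path_distinct[OF p_path]] k(1) by simp
  then have "\<tau> (p ! h) \<le> enat (Suc (path_length p + k))"
    using tenacity_nth_le_splice_edge[OF p_path q(1) h_less p(2)] q(2,3) k(2) edge
      min_path_last[OF p(1)]
    by (simp add: insert_commute)
  then have "enat N < enat (Suc (path_length p + k))"
    by (rule order.strict_trans2[OF last_above_tenacity[OF h]])
  then show ?thesis by simp
qed

context
  fixes N :: nat
  assumes based: "based_below (Suc N)" and tight: "min_paths_tight N" and aug: "enat N < min_aug"
begin

lemma blossom_base_mem:
  assumes p: "min_path v p" and v_tenacity: "\<tau> v \<le> enat N" and u: "u \<in> set p"
  shows "blossom_base N u \<in> set p"
proof (cases N)
  case 0
  then show ?thesis using u by simp
next
  case (Suc n)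
  then have "tight n p" using tight p v_tenacity unfolding min_paths_tight_def by simp
  then have b: "blossom_base n u \<in> set p" using tight_blossom_base_mem u by blast
  show ?thesis
  proof (cases "\<tau> (blossom_base n u) = enat N")
    case True
    then have "well_based (blossom_base n u)" using based unfolding based_below_def by simp
    then have "base V E M (blossom_base n u) \<in> set p"
      using base_of_high_tenacity_mem[OF p _ b] True v_tenacity by force
    then show ?thesis using True Suc by simp
  qed (use b Suc in simp)
qed

lemma blossom_base_after_last_above:
  assumes p: "min_path v p" and v_tenacity: "\<tau> v \<le> enat N" and h: "last_above (enat N) p h"
    and k: "h < k" "k < length p"
  shows "blossom_base N (p ! k) = p ! h"
proof -
  note p_distinct = search_path_distinct[OF min_path_search_path[OF p]]
  have "N \<noteq> 0" using v_tenacity tenacity_pos[of v] by (cases N) (auto simp: zero_enat_def)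
  then obtain n where n: "N = Suc n" by (cases N) auto
  then have tight_n: "tight n p" using tight p v_tenacity unfolding min_paths_tight_def by simp
  define b where "b = blossom_base n (p ! k)"
  have b_tenacity: "enat n < \<tau> b" using tenacity_blossom_base[OF based] n unfolding b_def by simp
  obtain j where j: "j < length p" "p ! j = b"
    using tight_blossom_base_mem[OF tight_n nth_mem[OF k(2)]] unfolding b_def in_set_conv_nth
    by auto
  have "enat n < \<tau> (p ! h)"
    using last_above_tenacity[OF h] n by (metis enat_ord_simps(2) lessI less_trans)
  then have h_le: "h \<le> j"
    using tight_blossom_base_index_ge[OF tight_n p_distinct _ k(2) _ j(1)] k(1) j(2) b_tenacity
    unfolding b_def by simp
  show ?thesis
  proof (cases "\<tau> b = enat N")
    case False
    then have "j \<le> h"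
      using last_above_greatest[OF h j(1)] enat_Suc_less[OF b_tenacity] j(2) n by simp
    then show ?thesis using h_le j(2) False n b_def by simp
  next
    case True
    then have h_less: "h < j"
      using h_le last_above_tenacity[OF h] j(2) by (metis less_irrefl le_neq_implies_less)
    have "well_based b" using based True unfolding based_below_def by simp
    moreover have "min_path b (take (Suc j) p)"
      using min_path_prefix[OF p _ j(1)] j(2) True v_tenacity by force
    ultimately obtain i where i: "last_above (\<tau> b) (take (Suc j) p) i"
      "take (Suc j) p ! i = base V E M b"
      by (rule well_basedE)
    have "i = h" using last_above_unique[OF i(1)] last_above_take[OF h] h_less True by simp
    then show ?thesis using i(2) h_less True n b_def by simp
  qed
qed

lemma
  assumes p: "min_path x p" and x_tenacity: "\<tau> x \<le> enat N" and h: "last_above (enat N) p h"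
  shows nth_last_above_eq_blossom_base: "p ! h = blossom_base N x"
    and level_blossom_base: "level True (blossom_base N x) = enat h"
proof -
  have less: "h < path_length p" using last_above_less_path_length[OF p x_tenacity h] .
  then show base: "p ! h = blossom_base N x"
    using blossom_base_after_last_above[OF p x_tenacity h, of "path_length p"]
      min_path_length[OF p] min_path_nth_last[OF p] by simp
  have "\<tau> x \<noteq> \<infinity>" "\<tau> x \<le> \<tau> (p ! h)"
    using x_tenacity last_above_tenacity[OF h] by (auto dest: enat_ile)
  then show "level True (blossom_base N x) = enat h"
    using level_nth_min_path[OF p _ last_above_less_length[OF h]]
      last_above_even[OF min_path_search_path[OF p] h less] base by simp
qed

lemma level_blossom_base_less:
  assumes x_tenacity: "\<tau> x \<le> enat N"
  shows "level True (blossom_base N x) + level True (blossom_base N x) < enat N"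
proof -
  have finite_tenacity: "\<tau> x \<noteq> \<infinity>" using x_tenacity by (auto dest: enat_ile)
  obtain p r where p: "min_path x p" "even (path_length p)"
    and r: "min_path x r" "odd (path_length r)"
    using min_paths_exist[OF finite_tenacity] .
  obtain h where h: "last_above (enat N) p h"
    using last_above_exists[OF min_path_search_path[OF p(1)] aug] .
  obtain g where g: "last_above (enat N) r g"
    using last_above_exists[OF min_path_search_path[OF r(1)] aug] .
  have "path_length p + path_length r \<le> N"
    using tenacity_eq_path_lengths[OF p(1) r(1)] p(2) r(2) x_tenacity by simp
  then have "h + g < N"
    using last_above_less_path_length[OF p(1) x_tenacity h]
      last_above_less_path_length[OF r(1) x_tenacity g]
    by simp
  then show ?thesis
    using level_blossom_base[OF p(1) x_tenacity h] level_blossom_base[OF r(1) x_tenacity g] by simp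
qed

lemma even_levels_ge_if_base_notin:
  assumes x_tenacity: "\<tau> x \<le> enat N" and y_tenacity: "\<tau> y \<le> enat N"
    and edge: "{y, x} \<in> E" "{y, x} \<notin> M"
    and p: "min_path x p" "even (path_length p)" and q: "min_path y q" "even (path_length q)"
    and notin: "blossom_base N x \<notin> set q"
  shows "N \<le> path_length p + path_length q"
proof -
  note p_path = min_path_search_path[OF p(1)] and q_path = min_path_search_path[OF q(1)]
  obtain h where h: "last_above (enat N) p h" using last_above_exists[OF p_path aug] .
  have "blossom_base N u = blossom_base N x" if u: "u \<in> set (drop h p)" for u
  proof -
    obtain d where "d < length (drop h p)" "drop h p ! d = u"
      using u unfolding in_set_conv_nth by blast
    then have "h + d < length p" "p ! (h + d) = u" by auto
    then show ?thesis
      using blossom_base_after_last_above[OF p(1) x_tenacity h, of "h + d"]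
        nth_last_above_eq_blossom_base[OF p(1) x_tenacity h]
        blossom_base_eq_self[OF last_above_tenacity[OF h]] by (cases "d = 0") auto
  qed
  then have "set q \<inter> set (drop h p) = {}"
    using blossom_base_mem[OF q(1) y_tenacity] notin by fastforce
  then have "\<tau> (p ! h) \<le> enat (Suc (path_length p + path_length q))"
    using p(2) q(2) edge min_path_last[OF p(1)] min_path_last[OF q(1)]
    by (intro tenacity_nth_le_splice_edge[OF p_path q_path last_above_less_length[OF h]]) auto
  then have "enat N < enat (Suc (path_length p + path_length q))"
    by (rule order.strict_trans2[OF last_above_tenacity[OF h]])
  then show ?thesis by simp
qed

lemma level_blossom_base_less_if_mem:
  assumes x_tenacity: "\<tau> x \<le> enat N" and y_tenacity: "\<tau> y \<le> enat N" and q: "min_path y q"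
    and mem: "blossom_base N x \<in> set q" and distinct: "blossom_base N x \<noteq> blossom_base N y"
  shows "level True (blossom_base N x) < level True (blossom_base N y)"
proof -
  obtain g where g: "last_above (enat N) q g"
    using last_above_exists[OF min_path_search_path[OF q] aug] .
  obtain k where k: "k < length q" "q ! k = blossom_base N x"
    using mem unfolding in_set_conv_nth by auto
  have above: "enat N < \<tau> (q ! k)" unfolding k(2) using tenacity_blossom_base[OF based] by simp
  have "k \<le> g" "k \<noteq> g"
    using last_above_greatest[OF g k(1) above] nth_last_above_eq_blossom_base[OF q y_tenacity g]
      k(2) distinct
    by auto
  then have k_less: "k < g" by simp
  have "\<tau> y \<noteq> \<infinity>" "\<tau> y \<le> \<tau> (q ! k)" using y_tenacity above by (auto dest: enat_ile)
  then have level: "level (even k) (blossom_base N x) = enat k"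
    using level_nth_min_path[OF q _ k(1)] k(2) by simp
  show ?thesis
  proof (cases "even k")
    case True
    then show ?thesis using level level_blossom_base[OF q y_tenacity g] k_less by simp
  next
    case False
    then have "enat N < level True (blossom_base N x) + enat k"
      using level above unfolding k(2) tenacity_eq_levels[of _ True] by simp
    then show ?thesis
      using level_blossom_base_less[OF x_tenacity] level_blossom_base_less[OF y_tenacity]
        level_blossom_base[OF q y_tenacity g] k_less
      by (cases "level True (blossom_base N x)") auto
  qed
qed

lemma even_levels_ge:
  assumes edge: "{x, y} \<in> E" "{x, y} \<notin> M" and x_tenacity: "\<tau> x \<le> enat N"
    and y_tenacity: "\<tau> y \<le> enat N"
    and distinct: "blossom_base N x \<noteq> blossom_base N y"
    and levels: "level True x = enat a" "level True y = enat b"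
  shows "N \<le> a + b"
proof -
  obtain p where p: "min_path x p" "even (path_length p)"
    using levels(1) by (metis (full_types) min_path_exists enat.distinct(1))
  obtain q where q: "min_path y q" "even (path_length q)"
    using levels(2) by (metis (full_types) min_path_exists enat.distinct(1))
  have lengths: "path_length p = a" "path_length q = b"
    using min_path_level[OF p(1)] min_path_level[OF q(1)] p(2) q(2) levels by auto
  have edge_yx: "{y, x} \<in> E" "{y, x} \<notin> M" using edge by (auto simp: insert_commute)
  have "blossom_base N x \<notin> set q \<or> blossom_base N y \<notin> set p"
    using level_blossom_base_less_if_mem[OF x_tenacity y_tenacity q(1)]
      level_blossom_base_less_if_mem[OF y_tenacity x_tenacity p(1)] distinct
    by (metis less_asym)
  then show ?thesis
  proof
    assume "blossom_base N x \<notin> set q"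
    then show ?thesis
      using even_levels_ge_if_base_notin[OF x_tenacity y_tenacity edge_yx p q] lengths by simp
  next
    assume "blossom_base N y \<notin> set p"
    then show ?thesis
      using even_levels_ge_if_base_notin[OF y_tenacity x_tenacity edge q p] lengths by simp
  qed
qed

lemma potential_sum_ge_mixed:
  assumes edge: "{x, y} \<in> E" "{x, y} \<notin> M"
    and x_tenacity: "\<tau> x \<le> enat N" and y_tenacity: "enat N < \<tau> y"
    and not_base: "blossom_base N x \<noteq> y"
  shows "- 2 \<le> potential (Suc N) x + potential (Suc N) y"
proof -
  have finite_tenacity: "\<tau> x \<noteq> \<infinity>" using x_tenacity by (auto dest: enat_ile)
  obtain p where p: "min_path x p" "even (path_length p)"
    using min_paths_exist[OF finite_tenacity] .
  note p_path = min_path_search_path[OF p(1)]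
  have "level True x = enat (path_length p)" "\<tau> x \<le> enat (Suc N)"
    using min_path_level[OF p(1)] p(2) x_tenacity by (auto intro: order_trans)
  then have x_potential: "potential (Suc N) x = 2 * int (path_length p) - int (Suc N)"
    using potential_outer by blast
  show ?thesis
  proof (cases "\<exists>k < length p. p ! k = y \<and> even k")
    case False
    then have "level False y \<le> enat (Suc (path_length p))"
      using level_odd_le_edge[OF p_path p(2), of y] edge min_path_last[OF p(1)]
        min_path_length[OF p(1)]
      by auto
    then show ?thesis
      using potential_sum_ge_if_odd_level_le[OF x_potential] y_tenacity by (simp add: Suc_ile_eq)
  next
    case True
    then obtain k where k: "k < length p" "p ! k = y" "even k" by blast
    obtain h where h: "last_above (enat N) p h" using last_above_exists[OF p_path aug] .
    have "k \<le> h" "k \<noteq> h"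
      using last_above_greatest[OF h k(1)] k(2) y_tenacity not_base
        nth_last_above_eq_blossom_base[OF p(1) x_tenacity h] by auto
    then have k_less: "k < h" by simp
    have "level True y = enat k"
      using level_nth_min_path[OF p(1) finite_tenacity k(1)] x_tenacity y_tenacity k(2,3) by simp
    then have "potential (Suc N) y = 2 * int k - int (Suc N)"
      using potential_outer[of y k "Suc N"] k_less level_blossom_base_less[OF x_tenacity]
        level_blossom_base[OF p(1) x_tenacity h] by simp
    then show ?thesis
      using x_potential path_length_ge_on_path[OF edge p h k_less k(3,2)] by simp
  qed
qed

lemma potential_sum_ge_distinct_blossoms:
  assumes edge: "{x, y} \<in> E" "{x, y} \<notin> M" and distinct: "blossom_base N x \<noteq> blossom_base N y"
  shows "- 2 \<le> potential (Suc N) x + potential (Suc N) y"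
proof -
  have edge_yx: "{y, x} \<in> E" "{y, x} \<notin> M" using edge by (auto simp: insert_commute)
  show ?thesis
  proof (cases "\<tau> x \<le> enat N"; cases "\<tau> y \<le> enat N")
    assume low: "\<tau> x \<le> enat N" "\<tau> y \<le> enat N"
    then obtain a b where levels: "level True x = enat a" "level True y = enat b"
      using level_finite[of x True] level_finite[of y True] by (cases "\<tau> x"; cases "\<tau> y") auto
    have "\<tau> x \<le> enat (Suc N)" "\<tau> y \<le> enat (Suc N)" using low by (auto intro: order_trans)
    then have "potential (Suc N) x = 2 * int a - int (Suc N)"
      "potential (Suc N) y = 2 * int b - int (Suc N)"
      using potential_outer levels by blast+
    then show ?thesis using even_levels_ge[OF edge low distinct levels] by simp
  next
    assume "\<tau> x \<le> enat N" "\<not> \<tau> y \<le> enat N"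
    then show ?thesis
      using potential_sum_ge_mixed[OF edge] distinct blossom_base_eq_self[of N y] by simp
  next
    assume "\<not> \<tau> x \<le> enat N" "\<tau> y \<le> enat N"
    then show ?thesis
      using potential_sum_ge_mixed[OF edge_yx] distinct blossom_base_eq_self[of N x]
      by (simp add: add.commute)
  next
    assume "\<not> \<tau> x \<le> enat N" "\<not> \<tau> y \<le> enat N"
    then have "enat (Suc N) \<le> \<tau> x" "enat (Suc N) \<le> \<tau> y" by (simp_all add: Suc_ile_eq)
    then show ?thesis using potential_sum_ge_above[OF edge] potential_sum_ge_above[OF edge_yx]
      by (cases "level True x \<le> level True y") (auto simp: add.commute)
  qed
qed

lemma potential_Suc_same_blossom:
  assumes same_blossom: "blossom_base N x = blossom_base N y" and distinct: "x \<noteq> y"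
  shows "potential (Suc N) x = potential N x - 1"
proof -
  obtain e where e: "level True x = enat e" "\<tau> x \<le> enat N \<or> 2 * e < N"
  proof (cases "\<tau> x \<le> enat N")
    case True
    then show ?thesis using that level_finite[of x True] by (cases "\<tau> x") auto
  next
    case False
    then have x: "blossom_base N x = x" using blossom_base_eq_self by simp
    then have "\<tau> y \<le> enat N" using same_blossom distinct blossom_base_eq_self by (metis not_le)
    then have "level True x + level True x < enat N"
      using level_blossom_base_less same_blossom x by metis
    then show ?thesis using that by (cases "level True x") auto
  qed
  moreover have "\<tau> x \<le> enat (Suc N) \<or> 2 * e < Suc N"
    using e(2) by (auto intro: order_trans)
  ultimately show ?thesis
    using potential_outer[OF e(1), of N] potential_outer[OF e(1), of "Suc N"] by simp
qed

lemma feasible_Suc: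
  assumes "feasible N"
  shows "feasible (Suc N)"
  unfolding feasible_def
proof (intro allI impI)
  fix x y assume edge: "{x, y} \<in> E" "{x, y} \<notin> M"
  have distinct: "x \<noteq> y" using edge_distinct[OF edge(1)] .
  show "- 2 \<le> potential (Suc N) x + potential (Suc N) y + 2 * int (common_blossoms (Suc N) x y)"
  proof (cases "blossom_base N x = blossom_base N y")
    case True
    have "{s. s < Suc N \<and> blossom_base s x = blossom_base s y} =
        insert N {s. s < N \<and> blossom_base s x = blossom_base s y}"
      using True by (auto simp: less_Suc_eq)
    then have "common_blossoms (Suc N) x y = Suc (common_blossoms N x y)"
      unfolding common_blossoms_def by simp
    moreover have "- 2 \<le> potential N x + potential N y + 2 * int (common_blossoms N x y)"
      using assms edge unfolding feasible_def by blast
    ultimately show ?thesis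
      using potential_Suc_same_blossom[OF True distinct]
        potential_Suc_same_blossom[OF True[symmetric] distinct[symmetric]]
      by simp
  next
    case False
    from potential_sum_ge_distinct_blossoms[OF edge this] show ?thesis by simp
  qed
qed

end

lemma based_below_and_feasible: "enat N \<le> min_aug \<Longrightarrow> based_below N \<and> feasible N"
proof (induction N)
  case 0
  then show ?case
    unfolding based_below_def feasible_def potential_def by (simp add: zero_enat_def[symmetric])
next
  case (Suc N)
  then have aug: "enat N < min_aug" by (simp add: Suc_ile_eq)
  then have IH: "based_below N" "feasible N" using Suc.IH by auto
  then have tight: "min_paths_tight N"
    using min_path_tight aug unfolding min_paths_tight_def by auto
  from based_below_Suc[OF IH(1) tight aug] feasible_Suc[OF _ tight aug IH(2)] show ?case by blast
qed

lemma well_based_if_tenacity_less: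
  assumes "\<tau> u < min_aug"
  shows "well_based u"
proof -
  obtain n where n: "\<tau> u = enat n" using assms by (cases "\<tau> u") auto
  then have "based_below (Suc n)" using assms based_below_and_feasible by (simp add: Suc_ile_eq)
  then show ?thesis using n unfolding based_below_def by simp
qed

lemma base_mem_min_path:
  assumes p: "min_path v p" and v_tenacity: "\<tau> v < min_aug"
    and u: "u \<in> set p" and u_tenacity: "\<tau> u < min_aug"
  shows "base V E M u \<in> set p"
proof (cases "\<tau> v \<le> \<tau> u")
  case True
  have "\<tau> v \<noteq> \<infinity>" using v_tenacity by (metis enat_ord_simps(6))
  then show ?thesis
    using base_of_high_tenacity_mem[OF p _ u True] well_based_if_tenacity_less[OF u_tenacity]
    by blast
next
  case False
  obtain n where n: "\<tau> u = enat n" using u_tenacity by (cases "\<tau> u") auto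
  obtain N where N: "\<tau> v = enat N" using v_tenacity by (cases "\<tau> v") auto
  then have "based_below N" "feasible N" "enat N \<le> min_aug"
    using based_below_and_feasible[of N] v_tenacity by auto
  then have "tight n p" using min_path_tight[OF _ _ _ p, of N n] N n False by simp
  from tight_blossom_base_mem[OF this u] show ?thesis using blossom_base_at_tenacity[OF n] by simp
qed

end

theorem theorem5:
  fixes V :: "'a set" and E M :: "'a set set" and v :: 'a and p :: "'a list"
  assumes "finite_graph V E"
    and "matching E M"
    and "\<exists>f. unmatched V M f"
    and "v \<in> V"
    and "all_iterated_bases_defined V E M v"
    and "evenlevel_path V E M v p \<or> oddlevel_path V E M v p"
  shows "\<forall>u \<in> set p. \<forall>k b. iterated_base V E M u k b \<longrightarrow> b \<in> set p"
proof -
  interpret matched_graph V E M using assms(1,2) by unfold_locales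
  have p: "min_path v p" using assms(6) unfolding min_path_def .
  have "\<tau> v < min_aug" if "iterated_base V E M v k b" for k b
    using that by induction
  then have v_tenacity: "\<tau> v < min_aug"
    using assms(5) unfolding all_iterated_bases_defined_def by blast
  have "b \<in> set p" if "iterated_base V E M u k b" "u \<in> set p" for u k b
    using that by induction (auto intro: base_mem_min_path[OF p v_tenacity])
  then show ?thesis by blast
qed

end
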